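(* Let $\pi$ be a group and let $\mathcal{T}$ be a strict braided T-category over $\pi$. Then the twist extension $\mathcal{T}^Z$, with the structure given in its definition, is a balanced T-category.
   Context: An object also denotes its identity arrow. **T-categories.** A T-category over $\pi$ is a tensor category $\mathcal{T}$ that is the disjoint union of subcategories $\{\mathcal{T}_\alpha\}_{\alpha\in\pi}$ (no arrows between different components) with $U\otimes V\in\mathcal{T}_{\alpha\beta}$ for $U\in\mathcal{T}_\alpha,V\in\mathcal{T}_\beta$, with a group homomorphism $\varphi:\pi\to\mathrm{aut}(\mathcal{T})$ (invertible strict tensor endofunctors) such that $\varphi_\beta(\mathcal{T}_\alpha)=\mathcal{T}_{\beta\alpha\beta^{-1}}$. For $V\in\mathcal{T}_\beta$ write ${}^V(\cdot)={}^\beta(\cdot)=\varphi_\beta$. **Braiding** (strict case): isomorphisms $c_{U,V}:U\otimes V\to{}^UV\otimes U$ with $({}^\alpha g\otimes f)c_{U,V}=c_{U',V'}(f\otimes g)$ for $f\in\mathcal{T}_\alpha(U,U')$, $g\in\mathcal{T}(V,V')$; $c_{U\otimes V,W}=(c_{U,{}^VW}\otimes V)(U\otimes c_{V,W})$; $c_{U,V\otimes W}=({}^UV\otimes c_{U,W})(c_{U,V}\otimes W)$; $\varphi_\beta(c_{U,V})=c_{\varphi_\beta(U),\varphi_\beta(V)}$. **Twist**: isomorphisms $\theta_U:U\to{}^UU$ with $\theta_Vf=({}^\alpha f)\theta_U$ for $f\in\mathcal{T}_\alpha(U,V)$; $\theta_{U\otimes V}=c_{{}^{U\otimes V}V,{}^UU}\circ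 c_{{}^UU,{}^VV}\circ(\theta_U\otimes\theta_V)$; $\varphi_\alpha(\theta_U)=\theta_{\varphi_\alpha(U)}$. Balanced T-category = braided T-category with a twist. **Twist extension $\mathcal{T}^Z$.** Objects: pairs $(U,t)$, $U\in\mathcal{T}$, $t\in\mathcal{T}(U,{}^UU)$ invertible. Arrows $(U_1,t_1)\to(U_2,t_2)$: $f\in\mathcal{T}(U_1,U_2)$ with $({}^{U_1}f)\circ t_1=t_2\circ f$, composed as in $\mathcal{T}$. Tensor product of objects $(U,t)\odot(U',t')=(U\otimes U',t\odot t')$ with $t\odot t'=c_{{}^{U\otimes U'}U',{}^UU}\circ c_{{}^UU,{}^{U'}U'}\circ(t\otimes t')$; of arrows as in $\mathcal{T}$; unit $(\mathbb{I},\mathrm{Id}_{\mathbb{I}})$. $\alpha$-th component: full subcategory of pairs with $U\in\mathcal{T}_\alpha$. Conjugation: $\varphi^Z_\beta(U,t)=(\varphi_\beta(U),\varphi_\beta(t))$, $\varphi^Z_\beta(f)=\varphi_\beta(f)$. Braiding: $c_{(U,t),(U',t')}=c_{U,U'}$. Twist: $\theta_{(U,t)}=t$. *)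

theory Defs
  imports "HOL-Algebra.Group"
begin

section \<open>Strict tensor categories and their automorphisms\<close>

text \<open>
  Every arrow has a unique domain and a unique codomain. Composition and tensor product
  of arrows are total functions whose values off the composable pairs, respectively off
  the category, are irrelevant.
\<close>

record ('o, 'm) tensor_category =
  Obj :: "'o set"
  Arr :: "'m set"
  Dom :: "'m \<Rightarrow> 'o"
  Cod :: "'m \<Rightarrow> 'o"
  Idt :: "'o \<Rightarrow> 'm"
  Comp :: "'m \<Rightarrow> 'm \<Rightarrow> 'm"  (infixr "\<bullet>\<index>" 55)
  Tens_obj :: "'o \<Rightarrow> 'o \<Rightarrow> 'o"  (infixr "\<boxtimes>\<index>" 70)
  Tens_arr :: "'m \<Rightarrow> 'm \<Rightarrow> 'm"  (infixr "\<boxdot>\<index>" 70)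
  Unit_obj :: "'o"

definition Hom :: "('o, 'm, 'x) tensor_category_scheme \<Rightarrow> 'o \<Rightarrow> 'o \<Rightarrow> 'm set" where
  "Hom C U V = {f \<in> Arr C. Dom C f = U \<and> Cod C f = V}"

definition is_iso :: "('o, 'm, 'x) tensor_category_scheme \<Rightarrow> 'm \<Rightarrow> bool" where
  "is_iso C f \<longleftrightarrow> f \<in> Arr C \<and>
     (\<exists>g \<in> Hom C (Cod C f) (Dom C f).
        g \<bullet>\<^bsub>C\<^esub> f = Idt C (Dom C f) \<and> f \<bullet>\<^bsub>C\<^esub> g = Idt C (Cod C f))"

locale strict_tensor_category =
  fixes C :: "('o, 'm, 'x) tensor_category_scheme" (structure)
  assumes Dom_closed: "f \<in> Arr C \<Longrightarrow> Dom C f \<in> Obj C"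
    and Cod_closed: "f \<in> Arr C \<Longrightarrow> Cod C f \<in> Obj C"
    and Idt_closed: "U \<in> Obj C \<Longrightarrow> Idt C U \<in> Hom C U U"
    and Comp_closed: "\<lbrakk>f \<in> Hom C U V; g \<in> Hom C V W\<rbrakk> \<Longrightarrow> g \<bullet> f \<in> Hom C U W"
    and Comp_Idt_left: "f \<in> Hom C U V \<Longrightarrow> Idt C V \<bullet> f = f"
    and Comp_Idt_right: "f \<in> Hom C U V \<Longrightarrow> f \<bullet> Idt C U = f"
    and Comp_assoc: "\<lbrakk>f \<in> Hom C U V; g \<in> Hom C V W; h \<in> Hom C W X\<rbrakk>
          \<Longrightarrow> (h \<bullet> g) \<bullet> f = h \<bullet> (g \<bullet> f)"
    and Tens_obj_closed: "\<lbrakk>U \<in> Obj C; V \<in> Obj C\<rbrakk> \<Longrightarrow> U \<boxtimes> V \<in> Obj C"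
    and Tens_arr_closed: "\<lbrakk>f \<in> Hom C U U'; g \<in> Hom C V V'\<rbrakk>
          \<Longrightarrow> f \<boxdot> g \<in> Hom C (U \<boxtimes> V) (U' \<boxtimes> V')"
    and Tens_Idt: "\<lbrakk>U \<in> Obj C; V \<in> Obj C\<rbrakk> \<Longrightarrow> Idt C U \<boxdot> Idt C V = Idt C (U \<boxtimes> V)"
    and Tens_Comp: "\<lbrakk>f \<in> Hom C U U'; f' \<in> Hom C U' U''; g \<in> Hom C V V'; g' \<in> Hom C V' V''\<rbrakk>
          \<Longrightarrow> (f' \<bullet> f) \<boxdot> (g' \<bullet> g) = (f' \<boxdot> g') \<bullet> (f \<boxdot> g)"
    and Unit_closed: "Unit_obj C \<in> Obj C"
    and Tens_obj_assoc: "\<lbrakk>U \<in> Obj C; V \<in> Obj C; W \<in> Obj C\<rbrakk>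
          \<Longrightarrow> (U \<boxtimes> V) \<boxtimes> W = U \<boxtimes> (V \<boxtimes> W)"
    and Tens_arr_assoc: "\<lbrakk>f \<in> Arr C; g \<in> Arr C; h \<in> Arr C\<rbrakk>
          \<Longrightarrow> (f \<boxdot> g) \<boxdot> h = f \<boxdot> (g \<boxdot> h)"
    and Tens_obj_unit: "U \<in> Obj C \<Longrightarrow> Unit_obj C \<boxtimes> U = U"
          "U \<in> Obj C \<Longrightarrow> U \<boxtimes> Unit_obj C = U"
    and Tens_arr_unit: "f \<in> Arr C \<Longrightarrow> Idt C (Unit_obj C) \<boxdot> f = f"
          "f \<in> Arr C \<Longrightarrow> f \<boxdot> Idt C (Unit_obj C) = f"

text \<open>An endofunctor is given by its object part and its arrow part.\<close>

definition strict_tensor_endofunctor ::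
  "('o, 'm, 'x) tensor_category_scheme \<Rightarrow> ('o \<Rightarrow> 'o) \<times> ('m \<Rightarrow> 'm) \<Rightarrow> bool" where
  "strict_tensor_endofunctor C F \<longleftrightarrow>
     (\<forall>U \<in> Obj C. fst F U \<in> Obj C) \<and>
     (\<forall>f \<in> Arr C. snd F f \<in> Hom C (fst F (Dom C f)) (fst F (Cod C f))) \<and>
     (\<forall>U \<in> Obj C. snd F (Idt C U) = Idt C (fst F U)) \<and>
     (\<forall>f \<in> Arr C. \<forall>g \<in> Arr C. Dom C g = Cod C f \<longrightarrow>
        snd F (g \<bullet>\<^bsub>C\<^esub> f) = snd F g \<bullet>\<^bsub>C\<^esub> snd F f) \<and>
     (\<forall>U \<in> Obj C. \<forall>V \<in> Obj C. fst F (U \<boxtimes>\<^bsub>C\<^esub> V) = fst F U \<boxtimes>\<^bsub>C\<^esub> fst F V) \<and>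
     (\<forall>f \<in> Arr C. \<forall>g \<in> Arr C. snd F (f \<boxdot>\<^bsub>C\<^esub> g) = snd F f \<boxdot>\<^bsub>C\<^esub> snd F g) \<and>
     fst F (Unit_obj C) = Unit_obj C"

text \<open>
  Both parts of an endofunctor are required to be extensional on objects and arrows,
  so that equality of functors is equality in HOL.
\<close>

definition tensor_End ::
  "('o, 'm, 'x) tensor_category_scheme \<Rightarrow> (('o \<Rightarrow> 'o) \<times> ('m \<Rightarrow> 'm)) monoid" where
  "tensor_End C =
     \<lparr>carrier = {F. strict_tensor_endofunctor C F \<and>
                    fst F \<in> extensional (Obj C) \<and> snd F \<in> extensional (Arr C)},
      mult = (\<lambda>F G. (compose (Obj C) (fst F) (fst G), compose (Arr C) (snd F) (snd G))),
      one = (\<lambda>U \<in> Obj C. U, \<lambda>f \<in> Arr C. f)\<rparr>"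

definition tensor_Aut ::
  "('o, 'm, 'x) tensor_category_scheme \<Rightarrow> (('o \<Rightarrow> 'o) \<times> ('m \<Rightarrow> 'm)) monoid" where
  "tensor_Aut C = units_of (tensor_End C)"


section \<open>T-categories\<close>

text \<open>\<open>Component T \<alpha>\<close> is the set of objects of the component with index \<open>\<alpha>\<close>.\<close>

record ('o, 'm, 'g) T_category = "('o, 'm) tensor_category" +
  Component :: "'g \<Rightarrow> 'o set"
  Conj :: "'g \<Rightarrow> ('o \<Rightarrow> 'o) \<times> ('m \<Rightarrow> 'm)"

definition Component_arr :: "('o, 'm, 'g, 'x) T_category_scheme \<Rightarrow> 'g \<Rightarrow> 'm set" where
  "Component_arr T \<alpha> = {f \<in> Arr T. Dom T f \<in> Component T \<alpha> \<and> Cod T f \<in> Component T \<alpha>}"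

definition conj_obj :: "('o, 'm, 'g, 'x) T_category_scheme \<Rightarrow> 'g \<Rightarrow> 'o \<Rightarrow> 'o" where
  "conj_obj T \<beta> = fst (Conj T \<beta>)"

definition conj_arr :: "('o, 'm, 'g, 'x) T_category_scheme \<Rightarrow> 'g \<Rightarrow> 'm \<Rightarrow> 'm" where
  "conj_arr T \<beta> = snd (Conj T \<beta>)"

locale T_category = group G + strict_tensor_category T
  for G :: "('g, 'r) monoid_scheme" (structure)
  and T :: "('o, 'm, 'g, 'x) T_category_scheme" +
  assumes Obj_Component: "Obj T = (\<Union>\<alpha> \<in> carrier G. Component T \<alpha>)"
    and Arr_Component: "Arr T = (\<Union>\<alpha> \<in> carrier G. Component_arr T \<alpha>)"
    and Component_disjoint: "\<lbrakk>\<alpha> \<in> carrier G; \<beta> \<in> carrier G; \<alpha> \<noteq> \<beta>\<rbrakk>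
          \<Longrightarrow> Component T \<alpha> \<inter> Component T \<beta> = {}"
    and Component_Tens: "\<lbrakk>\<alpha> \<in> carrier G; \<beta> \<in> carrier G; U \<in> Component T \<alpha>; V \<in> Component T \<beta>\<rbrakk>
          \<Longrightarrow> U \<boxtimes>\<^bsub>T\<^esub> V \<in> Component T (\<alpha> \<otimes> \<beta>)"
    and Conj_hom: "Conj T \<in> hom G (tensor_Aut T)"
    and Conj_Component: "\<lbrakk>\<alpha> \<in> carrier G; \<beta> \<in> carrier G\<rbrakk>
          \<Longrightarrow> conj_obj T \<beta> ` Component T \<alpha> = Component T (\<beta> \<otimes> \<alpha> \<otimes> inv \<beta>)"
    and Conj_Component_arr: "\<lbrakk>\<alpha> \<in> carrier G; \<beta> \<in> carrier G\<rbrakk>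
          \<Longrightarrow> conj_arr T \<beta> ` Component_arr T \<alpha> = Component_arr T (\<beta> \<otimes> \<alpha> \<otimes> inv \<beta>)"

text \<open>The index of the component of an object, unique by disjointness.\<close>

definition degree ::
  "('g, 'r) monoid_scheme \<Rightarrow> ('o, 'm, 'g, 'x) T_category_scheme \<Rightarrow> 'o \<Rightarrow> 'g" where
  "degree G T U = (THE \<alpha>. \<alpha> \<in> carrier G \<and> U \<in> Component T \<alpha>)"

text \<open>The left exponents \<open>\<^sup>UV\<close> and \<open>\<^sup>Uf\<close>.\<close>

definition act_obj ::
  "('g, 'r) monoid_scheme \<Rightarrow> ('o, 'm, 'g, 'x) T_category_scheme \<Rightarrow> 'o \<Rightarrow> 'o \<Rightarrow> 'o" where
  "act_obj G T U V = conj_obj T (degree G T U) V"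

definition act_arr ::
  "('g, 'r) monoid_scheme \<Rightarrow> ('o, 'm, 'g, 'x) T_category_scheme \<Rightarrow> 'o \<Rightarrow> 'm \<Rightarrow> 'm" where
  "act_arr G T U f = conj_arr T (degree G T U) f"


section \<open>Braidings and twists\<close>

record ('o, 'm, 'g) braided_T_category = "('o, 'm, 'g) T_category" +
  Braid :: "'o \<Rightarrow> 'o \<Rightarrow> 'm"

locale braided_T_category = T_category G T
  for G :: "('g, 'r) monoid_scheme" (structure)
  and T :: "('o, 'm, 'g, 'x) braided_T_category_scheme" +
  assumes Braid_closed: "\<lbrakk>U \<in> Obj T; V \<in> Obj T\<rbrakk>
          \<Longrightarrow> Braid T U V \<in> Hom T (U \<boxtimes>\<^bsub>T\<^esub> V) (act_obj G T U V \<boxtimes>\<^bsub>T\<^esub> U)"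
    and Braid_iso: "\<lbrakk>U \<in> Obj T; V \<in> Obj T\<rbrakk> \<Longrightarrow> is_iso T (Braid T U V)"
    and Braid_natural:
      "\<lbrakk>\<alpha> \<in> carrier G; U \<in> Component T \<alpha>; U' \<in> Component T \<alpha>; f \<in> Hom T U U'; g \<in> Hom T V V'\<rbrakk>
          \<Longrightarrow> (conj_arr T \<alpha> g \<boxdot>\<^bsub>T\<^esub> f) \<bullet>\<^bsub>T\<^esub> Braid T U V = Braid T U' V' \<bullet>\<^bsub>T\<^esub> (f \<boxdot>\<^bsub>T\<^esub> g)"
    and Braid_Tens_left: "\<lbrakk>U \<in> Obj T; V \<in> Obj T; W \<in> Obj T\<rbrakk>
          \<Longrightarrow> Braid T (U \<boxtimes>\<^bsub>T\<^esub> V) W =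
              (Braid T U (act_obj G T V W) \<boxdot>\<^bsub>T\<^esub> Idt T V) \<bullet>\<^bsub>T\<^esub> (Idt T U \<boxdot>\<^bsub>T\<^esub> Braid T V W)"
    and Braid_Tens_right: "\<lbrakk>U \<in> Obj T; V \<in> Obj T; W \<in> Obj T\<rbrakk>
          \<Longrightarrow> Braid T U (V \<boxtimes>\<^bsub>T\<^esub> W) =
              (Idt T (act_obj G T U V) \<boxdot>\<^bsub>T\<^esub> Braid T U W) \<bullet>\<^bsub>T\<^esub> (Braid T U V \<boxdot>\<^bsub>T\<^esub> Idt T W)"
    and Braid_Conj: "\<lbrakk>\<beta> \<in> carrier G; U \<in> Obj T; V \<in> Obj T\<rbrakk>
          \<Longrightarrow> conj_arr T \<beta> (Braid T U V) = Braid T (conj_obj T \<beta> U) (conj_obj T \<beta> V)"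

record ('o, 'm, 'g) balanced_T_category = "('o, 'm, 'g) braided_T_category" +
  Twist :: "'o \<Rightarrow> 'm"

locale balanced_T_category = braided_T_category G T
  for G :: "('g, 'r) monoid_scheme" (structure)
  and T :: "('o, 'm, 'g, 'x) balanced_T_category_scheme" +
  assumes Twist_closed: "U \<in> Obj T \<Longrightarrow> Twist T U \<in> Hom T U (act_obj G T U U)"
    and Twist_iso: "U \<in> Obj T \<Longrightarrow> is_iso T (Twist T U)"
    and Twist_natural:
      "\<lbrakk>\<alpha> \<in> carrier G; U \<in> Component T \<alpha>; V \<in> Component T \<alpha>; f \<in> Hom T U V\<rbrakk>
          \<Longrightarrow> Twist T V \<bullet>\<^bsub>T\<^esub> f = conj_arr T \<alpha> f \<bullet>\<^bsub>T\<^esub> Twist T U"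
    and Twist_Tens: "\<lbrakk>U \<in> Obj T; V \<in> Obj T\<rbrakk>
          \<Longrightarrow> Twist T (U \<boxtimes>\<^bsub>T\<^esub> V) =
              Braid T (act_obj G T (U \<boxtimes>\<^bsub>T\<^esub> V) V) (act_obj G T U U) \<bullet>\<^bsub>T\<^esub>
              Braid T (act_obj G T U U) (act_obj G T V V) \<bullet>\<^bsub>T\<^esub>
              (Twist T U \<boxdot>\<^bsub>T\<^esub> Twist T V)"
    and Twist_Conj: "\<lbrakk>\<alpha> \<in> carrier G; U \<in> Obj T\<rbrakk>
          \<Longrightarrow> conj_arr T \<alpha> (Twist T U) = Twist T (conj_obj T \<alpha> U)"


section \<open>The twist extension\<close>

definition Z_Obj ::
  "('g, 'r) monoid_scheme \<Rightarrow> ('o, 'm, 'g, 'x) braided_T_category_scheme \<Rightarrow> ('o \<times> 'm) set" where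
  "Z_Obj G T = {(U, t). U \<in> Obj T \<and> t \<in> Hom T U (act_obj G T U U) \<and> is_iso T t}"

text \<open>
  The same arrow of \<open>T\<close> may underlie arrows of the extension between different
  pairs of objects, so an arrow \<open>f\<close> from \<open>X\<close> to \<open>Y\<close> is encoded as
  the triple \<open>(X, f, Y)\<close>.
\<close>

type_synonym ('o, 'm) z_arr = "('o \<times> 'm) \<times> 'm \<times> ('o \<times> 'm)"

definition Z_Arr ::
  "('g, 'r) monoid_scheme \<Rightarrow> ('o, 'm, 'g, 'x) braided_T_category_scheme \<Rightarrow> ('o, 'm) z_arr set" where
  "Z_Arr G T = {((U\<^sub>1, t\<^sub>1), f, (U\<^sub>2, t\<^sub>2)) | U\<^sub>1 t\<^sub>1 f U\<^sub>2 t\<^sub>2.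
     (U\<^sub>1, t\<^sub>1) \<in> Z_Obj G T \<and> (U\<^sub>2, t\<^sub>2) \<in> Z_Obj G T \<and> f \<in> Hom T U\<^sub>1 U\<^sub>2 \<and>
     act_arr G T U\<^sub>1 f \<bullet>\<^bsub>T\<^esub> t\<^sub>1 = t\<^sub>2 \<bullet>\<^bsub>T\<^esub> f}"

definition Z_tens ::
  "('g, 'r) monoid_scheme \<Rightarrow> ('o, 'm, 'g, 'x) braided_T_category_scheme \<Rightarrow>
   'o \<times> 'm \<Rightarrow> 'o \<times> 'm \<Rightarrow> 'o \<times> 'm" where
  "Z_tens G T = (\<lambda>(U, t) (U', t').
     (U \<boxtimes>\<^bsub>T\<^esub> U',
      Braid T (act_obj G T (U \<boxtimes>\<^bsub>T\<^esub> U') U') (act_obj G T U U) \<bullet>\<^bsub>T\<^esub>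
      Braid T (act_obj G T U U) (act_obj G T U' U') \<bullet>\<^bsub>T\<^esub>
      (t \<boxdot>\<^bsub>T\<^esub> t')))"

definition Z_conj_obj ::
  "('o, 'm, 'g, 'x) braided_T_category_scheme \<Rightarrow> 'g \<Rightarrow> 'o \<times> 'm \<Rightarrow> 'o \<times> 'm" where
  "Z_conj_obj T \<beta> = (\<lambda>(U, t). (conj_obj T \<beta> U, conj_arr T \<beta> t))"

definition Z_conj_arr ::
  "('o, 'm, 'g, 'x) braided_T_category_scheme \<Rightarrow> 'g \<Rightarrow> ('o, 'm) z_arr \<Rightarrow> ('o, 'm) z_arr" where
  "Z_conj_arr T \<beta> = (\<lambda>(X, f, Y). (Z_conj_obj T \<beta> X, conj_arr T \<beta> f, Z_conj_obj T \<beta> Y))"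

definition twist_extension ::
  "('g, 'r) monoid_scheme \<Rightarrow> ('o, 'm, 'g, 'x) braided_T_category_scheme \<Rightarrow>
   ('o \<times> 'm, ('o, 'm) z_arr, 'g) balanced_T_category" where
  "twist_extension G T =
     \<lparr>Obj = Z_Obj G T,
      Arr = Z_Arr G T,
      Dom = (\<lambda>(X, f, Y). X),
      Cod = (\<lambda>(X, f, Y). Y),
      Idt = (\<lambda>(U, t). ((U, t), Idt T U, (U, t))),
      Comp = (\<lambda>(Y, g, Z) (X, f, Y'). (X, g \<bullet>\<^bsub>T\<^esub> f, Z)),
      Tens_obj = Z_tens G T,
      Tens_arr = (\<lambda>(X, f, Y) (X', f', Y'). (Z_tens G T X X', f \<boxdot>\<^bsub>T\<^esub> f', Z_tens G T Y Y')),
      Unit_obj = (Unit_obj T, Idt T (Unit_obj T)),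
      Component = (\<lambda>\<alpha>. {(U, t) \<in> Z_Obj G T. U \<in> Component T \<alpha>}),
      Conj = (\<lambda>\<beta>. (restrict (Z_conj_obj T \<beta>) (Z_Obj G T), restrict (Z_conj_arr T \<beta>) (Z_Arr G T))),
      Braid = (\<lambda>(U, t) (U', t').
        (Z_tens G T (U, t) (U', t'),
         Braid T U U',
         Z_tens G T (Z_conj_obj T (degree G T U) (U', t')) (U, t))),
      Twist = (\<lambda>(U, t). ((U, t), t, Z_conj_obj T (degree G T U) (U, t)))\<rparr>"

end

(*
  Put D(U,V) = c_{^U V,U} c_{U,V}. Then the twist of (U,t) \<odot> (V,s) is D(^U U, ^V V) (t \<otimes> s), and D
  inherits naturality and compatibility with conjugation from c. Naturality of D makes tensor
  products of arrows of the extension again arrows, and naturality of c does the same for the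
  braiding. Associativity of \<odot> reduces to the equality of the two ways of building the full twist
  on three strands out of D (lemma monodromy_assoc). For the unit, the hexagons make c_{I,U} and
  c_{U,I} idempotent isomorphisms, hence identities.
*)
theory Submission
  imports Defs
begin

section \<open>Strict tensor categories and T-categories\<close>

text \<open>An arrow of the extension carries its end objects, and these carry twists, so every
  equation between such arrows also demands equal twists at both ends. This is why associativity,
  units and conjugation of \<open>Z_tens\<close> are needed as exact equalities of pairs, and why
  they reappear in the hexagons of the extension. The other burden is the bookkeeping of exponents.
  Put a = deg U and b = deg V. Then D(U,V) ends in ^(a b a^-1) U \<otimes> ^a V. Since ^a U again
  has degree a, the arrow D(^a U, ^b V) ends in ^(ab) (U \<otimes> V), which is exactly the codomain
  that a twist on U \<otimes> V must have.\<close>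

context strict_tensor_category
begin

lemma Hom_iff: "f \<in> Hom C U V \<longleftrightarrow> f \<in> Arr C \<and> Dom C f = U \<and> Cod C f = V"
  by (simp add: Hom_def)

lemma Arr_Hom: "f \<in> Arr C \<Longrightarrow> f \<in> Hom C (Dom C f) (Cod C f)"
  by (simp add: Hom_iff)

text \<open>Typing goes through \<open>Dom\<close> and \<open>Cod\<close> as rewrite rules, so that
  the simplifier computes the ends of a composite instead of having to guess the intermediate
  objects of \<open>Hom\<close>.\<close>

lemma Comp_typing [simp]:
  assumes "f \<in> Arr C" "g \<in> Arr C" "Dom C g = Cod C f"
  shows "g \<bullet> f \<in> Arr C" "Dom C (g \<bullet> f) = Dom C f" "Cod C (g \<bullet> f) = Cod C g"
  using Comp_closed[of f "Dom C f" "Cod C f" g "Cod C g"] assms by (auto simp: Hom_iff)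

lemma Tens_typing [simp]:
  assumes "f \<in> Arr C" "g \<in> Arr C"
  shows "f \<boxdot> g \<in> Arr C" "Dom C (f \<boxdot> g) = Dom C f \<boxtimes> Dom C g"
    "Cod C (f \<boxdot> g) = Cod C f \<boxtimes> Cod C g"
  using Tens_arr_closed[OF Arr_Hom Arr_Hom, OF assms] by (auto simp: Hom_iff)

lemma Idt_typing [simp]:
  assumes "U \<in> Obj C"
  shows "Idt C U \<in> Arr C" "Dom C (Idt C U) = U" "Cod C (Idt C U) = U"
  using Idt_closed[OF assms] by (auto simp: Hom_iff)

lemma Comp_Idt [simp]:
  "\<lbrakk>f \<in> Arr C; Cod C f = U\<rbrakk> \<Longrightarrow> Idt C U \<bullet> f = f"
  "\<lbrakk>f \<in> Arr C; Dom C f = U\<rbrakk> \<Longrightarrow> f \<bullet> Idt C U = f"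
  using Comp_Idt_left Comp_Idt_right by (auto simp: Hom_iff)

lemma Comp_assoc_Arr:
  "\<lbrakk>f \<in> Arr C; g \<in> Arr C; h \<in> Arr C; Dom C g = Cod C f; Dom C h = Cod C g\<rbrakk>
    \<Longrightarrow> (h \<bullet> g) \<bullet> f = h \<bullet> (g \<bullet> f)"
  using Comp_assoc[of f _ _ g _ h] by (auto simp: Hom_iff)

lemma interchange:
  "\<lbrakk>f \<in> Arr C; f' \<in> Arr C; g \<in> Arr C; g' \<in> Arr C; Dom C f' = Cod C f; Dom C g' = Cod C g\<rbrakk>
    \<Longrightarrow> (f' \<boxdot> g') \<bullet> (f \<boxdot> g) = (f' \<bullet> f) \<boxdot> (g' \<bullet> g)"
  using Tens_Comp[of f _ _ f' _ g _ _ g'] by (auto simp: Hom_iff)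

declare Dom_closed [simp] Cod_closed [simp] Tens_obj_closed [simp] Tens_Idt [simp]
  Unit_closed [simp] Tens_obj_unit [simp] Tens_arr_unit [simp]

text \<open>As a rewrite rule this splits a tensor product, whereas \<open>interchange\<close>
  merges two of them.\<close>

lemma whisker_right:
  "\<lbrakk>f \<in> Arr C; g \<in> Arr C; Dom C g = Cod C f; W \<in> Obj C\<rbrakk>
    \<Longrightarrow> (g \<bullet> f) \<boxdot> Idt C W = (g \<boxdot> Idt C W) \<bullet> (f \<boxdot> Idt C W)"
  by (simp add: interchange)

lemma is_isoI:
  "\<lbrakk>f \<in> Arr C; g \<in> Arr C; Dom C g = Cod C f; Cod C g = Dom C f;
    g \<bullet> f = Idt C (Dom C f); f \<bullet> g = Idt C (Cod C f)\<rbrakk> \<Longrightarrow> is_iso C f"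
  by (auto simp: is_iso_def Hom_iff)

lemma is_isoE:
  assumes "is_iso C f"
  obtains g where "f \<in> Arr C" "g \<in> Arr C" "Dom C g = Cod C f" "Cod C g = Dom C f"
    "g \<bullet> f = Idt C (Dom C f)" "f \<bullet> g = Idt C (Cod C f)"
  using assms by (auto simp: is_iso_def Hom_iff)

lemma is_iso_Comp:
  assumes "is_iso C f" "is_iso C g" "Dom C g = Cod C f"
  shows "is_iso C (g \<bullet> f)"
proof -
  from assms(1) obtain f' where f: "f \<in> Arr C" "f' \<in> Arr C" "Dom C f' = Cod C f"
    "Cod C f' = Dom C f" "f' \<bullet> f = Idt C (Dom C f)" "f \<bullet> f' = Idt C (Cod C f)"
    by (rule is_isoE)
  from assms(2) obtain g' where g: "g \<in> Arr C" "g' \<in> Arr C" "Dom C g' = Cod C g"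
    "Cod C g' = Dom C g" "g' \<bullet> g = Idt C (Dom C g)" "g \<bullet> g' = Idt C (Cod C g)"
    by (rule is_isoE)
  have 1: "(f' \<bullet> g') \<bullet> (g \<bullet> f) = Idt C (Dom C f)"
  proof -
    have "(f' \<bullet> g') \<bullet> (g \<bullet> f) = f' \<bullet> ((g' \<bullet> g) \<bullet> f)"
      using f g(1-4) assms(3) by (simp add: Comp_assoc_Arr)
    then show ?thesis using f g assms(3) by simp
  qed
  have 2: "(g \<bullet> f) \<bullet> (f' \<bullet> g') = Idt C (Cod C g)"
  proof -
    have "(g \<bullet> f) \<bullet> (f' \<bullet> g') = g \<bullet> ((f \<bullet> f') \<bullet> g')"
      using f(1-4) g assms(3) by (simp add: Comp_assoc_Arr)
    then show ?thesis using f g assms(3) by simp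
  qed
  show ?thesis
    by (rule is_isoI[of _ "f' \<bullet> g'"]) (use f g assms(3) 1 2 in simp_all)
qed

lemma is_iso_Tens:
  assumes "is_iso C f" "is_iso C g"
  shows "is_iso C (f \<boxdot> g)"
proof -
  from assms(1) obtain f' where f: "f \<in> Arr C" "f' \<in> Arr C" "Dom C f' = Cod C f"
    "Cod C f' = Dom C f" "f' \<bullet> f = Idt C (Dom C f)" "f \<bullet> f' = Idt C (Cod C f)"
    by (rule is_isoE)
  from assms(2) obtain g' where g: "g \<in> Arr C" "g' \<in> Arr C" "Dom C g' = Cod C g"
    "Cod C g' = Dom C g" "g' \<bullet> g = Idt C (Dom C g)" "g \<bullet> g' = Idt C (Cod C g)"
    by (rule is_isoE)
  show ?thesis
    by (rule is_isoI[of _ "f' \<boxdot> g'"]) (use f g in \<open>simp_all add: interchange\<close>)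
qed

lemma is_iso_Idt: "U \<in> Obj C \<Longrightarrow> is_iso C (Idt C U)"
  by (rule is_isoI[of _ "Idt C U"]) simp_all

lemma idempotent_iso_eq_Idt:
  assumes "is_iso C f" "Cod C f = Dom C f" "f \<bullet> f = f"
  shows "f = Idt C (Dom C f)"
proof -
  from assms(1) obtain g where g: "f \<in> Arr C" "g \<in> Arr C" "Dom C g = Cod C f"
    "Cod C g = Dom C f" "g \<bullet> f = Idt C (Dom C f)" "f \<bullet> g = Idt C (Cod C f)"
    by (rule is_isoE)
  have "f = (g \<bullet> f) \<bullet> f" using g assms by simp
  also have "\<dots> = g \<bullet> (f \<bullet> f)" using g(1-4) assms(2) by (simp add: Comp_assoc_Arr)
  finally show ?thesis using assms(3) g by simp
qed

end

section \<open>Degrees and conjugation functors of a T-category\<close>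

context T_category
begin

abbreviation comp_T (infixr "\<bullet>\<^sub>T" 55) where "g \<bullet>\<^sub>T f \<equiv> g \<bullet>\<^bsub>T\<^esub> f"
abbreviation tens_obj_T (infixr "\<boxtimes>\<^sub>T" 70) where "U \<boxtimes>\<^sub>T V \<equiv> U \<boxtimes>\<^bsub>T\<^esub> V"
abbreviation tens_arr_T (infixr "\<boxdot>\<^sub>T" 70) where "f \<boxdot>\<^sub>T g \<equiv> f \<boxdot>\<^bsub>T\<^esub> g"
abbreviation deg where "deg \<equiv> degree G T"

lemma degree_eqI:
  assumes "\<alpha> \<in> carrier G" "U \<in> Component T \<alpha>"
  shows "deg U = \<alpha>"
  unfolding degree_def
  by (rule the_equality) (use assms Component_disjoint in blast)+

lemma degree_Obj:
  assumes "U \<in> Obj T"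
  shows degree_closed [simp]: "deg U \<in> carrier G" and Component_degree: "U \<in> Component T (deg U)"
proof -
  obtain \<alpha> where "\<alpha> \<in> carrier G" "U \<in> Component T \<alpha>"
    using assms Obj_Component by auto
  then show "deg U \<in> carrier G" "U \<in> Component T (deg U)"
    by (simp_all add: degree_eqI)
qed

lemma Component_iff:
  "\<alpha> \<in> carrier G \<Longrightarrow> U \<in> Component T \<alpha> \<longleftrightarrow> U \<in> Obj T \<and> deg U = \<alpha>"
  using Component_degree degree_eqI Obj_Component by auto

lemma degree_Tens [simp]:
  "\<lbrakk>U \<in> Obj T; V \<in> Obj T\<rbrakk> \<Longrightarrow> deg (U \<boxtimes>\<^sub>T V) = deg U \<otimes> deg V"
  by (intro degree_eqI Component_Tens) (simp_all add: Component_degree)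

text \<open>No arrow joins different components. Hence a single exponent serves both ends of an
  arrow in every naturality square below.\<close>

lemma degree_Cod:
  assumes "f \<in> Arr T"
  shows "deg (Cod T f) = deg (Dom T f)"
proof -
  obtain \<alpha> where "\<alpha> \<in> carrier G" "f \<in> Component_arr T \<alpha>"
    using assms Arr_Component by auto
  then show ?thesis by (simp add: Component_arr_def degree_eqI)
qed

text \<open>Because I \<otimes> I = I, this degree is an idempotent element of a group, hence
  neutral.\<close>

lemma degree_Unit [simp]: "deg (Unit_obj T) = \<one>"
proof -
  have "deg (Unit_obj T) \<otimes> deg (Unit_obj T) = deg (Unit_obj T)"
    using degree_Tens[of "Unit_obj T" "Unit_obj T"] by simp
  then show ?thesis using degree_closed[OF Unit_closed] by simp
qed

lemma Conj_functor:
  assumes "\<beta> \<in> carrier G"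
  shows "strict_tensor_endofunctor T (Conj T \<beta>)"
    and "fst (Conj T \<beta>) \<in> extensional (Obj T)" "snd (Conj T \<beta>) \<in> extensional (Arr T)"
proof -
  have "Conj T \<beta> \<in> carrier (tensor_Aut T)"
    using hom_in_carrier[OF Conj_hom assms] .
  then have "Conj T \<beta> \<in> carrier (tensor_End T)"
    by (simp add: tensor_Aut_def units_of_def Units_def)
  then show "strict_tensor_endofunctor T (Conj T \<beta>)"
    "fst (Conj T \<beta>) \<in> extensional (Obj T)" "snd (Conj T \<beta>) \<in> extensional (Arr T)"
    by (simp_all add: tensor_End_def)
qed

lemma conj_functor [simp]:
  assumes "\<beta> \<in> carrier G"
  shows conj_obj_closed: "U \<in> Obj T \<Longrightarrow> conj_obj T \<beta> U \<in> Obj T"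
    and conj_arr_closed: "f \<in> Arr T \<Longrightarrow> conj_arr T \<beta> f \<in> Arr T"
    and Dom_conj_arr: "f \<in> Arr T \<Longrightarrow> Dom T (conj_arr T \<beta> f) = conj_obj T \<beta> (Dom T f)"
    and Cod_conj_arr: "f \<in> Arr T \<Longrightarrow> Cod T (conj_arr T \<beta> f) = conj_obj T \<beta> (Cod T f)"
    and conj_arr_Idt: "U \<in> Obj T \<Longrightarrow> conj_arr T \<beta> (Idt T U) = Idt T (conj_obj T \<beta> U)"
    and conj_arr_Comp: "\<lbrakk>f \<in> Arr T; g \<in> Arr T; Dom T g = Cod T f\<rbrakk>
      \<Longrightarrow> conj_arr T \<beta> (g \<bullet>\<^sub>T f) = conj_arr T \<beta> g \<bullet>\<^sub>T conj_arr T \<beta> f"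
    and conj_obj_Tens: "\<lbrakk>U \<in> Obj T; V \<in> Obj T\<rbrakk>
      \<Longrightarrow> conj_obj T \<beta> (U \<boxtimes>\<^sub>T V) = conj_obj T \<beta> U \<boxtimes>\<^sub>T conj_obj T \<beta> V"
    and conj_arr_Tens: "\<lbrakk>f \<in> Arr T; g \<in> Arr T\<rbrakk>
      \<Longrightarrow> conj_arr T \<beta> (f \<boxdot>\<^sub>T g) = conj_arr T \<beta> f \<boxdot>\<^sub>T conj_arr T \<beta> g"
    and conj_obj_Unit: "conj_obj T \<beta> (Unit_obj T) = Unit_obj T"
  using Conj_functor(1)[OF assms]
  by (auto simp: strict_tensor_endofunctor_def conj_obj_def conj_arr_def Hom_iff)

lemma degree_conj_obj [simp]:
  assumes "\<beta> \<in> carrier G" "U \<in> Obj T"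
  shows "deg (conj_obj T \<beta> U) = \<beta> \<otimes> deg U \<otimes> inv \<beta>"
proof (rule degree_eqI)
  have "conj_obj T \<beta> U \<in> conj_obj T \<beta> ` Component T (deg U)"
    using assms(2) Component_degree by blast
  then show "conj_obj T \<beta> U \<in> Component T (\<beta> \<otimes> deg U \<otimes> inv \<beta>)"
    using assms by (simp add: Conj_Component)
qed (use assms in simp)

lemma Conj_mult:
  assumes "\<alpha> \<in> carrier G" "\<beta> \<in> carrier G"
  shows "Conj T (\<alpha> \<otimes> \<beta>) =
    (compose (Obj T) (conj_obj T \<alpha>) (conj_obj T \<beta>), compose (Arr T) (conj_arr T \<alpha>) (conj_arr T \<beta>))"
  using hom_mult[OF Conj_hom assms]
  by (simp add: tensor_Aut_def units_of_def tensor_End_def conj_obj_def conj_arr_def)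

text \<open>Collapses nested conjugations into one, so that comparing conjugates becomes a word
  problem in the group, left to \<open>m_assoc\<close> and cancellation.\<close>

lemma conj_conj [simp]:
  assumes "\<alpha> \<in> carrier G" "\<beta> \<in> carrier G"
  shows conj_obj_conj_obj: "U \<in> Obj T \<Longrightarrow> conj_obj T \<alpha> (conj_obj T \<beta> U) = conj_obj T (\<alpha> \<otimes> \<beta>) U"
    and conj_arr_conj_arr: "f \<in> Arr T \<Longrightarrow> conj_arr T \<alpha> (conj_arr T \<beta> f) = conj_arr T (\<alpha> \<otimes> \<beta>) f"
  using Conj_mult[OF assms] by (simp_all add: conj_obj_def[of T "\<alpha> \<otimes> \<beta>"]
    conj_arr_def[of T "\<alpha> \<otimes> \<beta>"] compose_def)

text \<open>A direct argument that does not go through a group structure on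
  \<open>tensor_Aut T\<close>. Let c be conjugation by \<open>\<one>\<close> and \<open>F\<close> a
  left inverse of it. Then F(c(U)) = U and F(c(c(U))) = c(U), while c(c(U)) = c(U); so c(U) = U, and
  likewise for arrows. Extensionality turns this into an equality of functors.\<close>

lemma Conj_one: "Conj T \<one> = (\<lambda>U \<in> Obj T. U, \<lambda>f \<in> Arr T. f)"
proof -
  let ?E = "tensor_End T"
  have carr: "Conj T \<one> \<in> Units ?E"
    using hom_in_carrier[OF Conj_hom one_closed] by (simp add: tensor_Aut_def units_of_def)
  have one: "mult ?E (Conj T \<one>) (Conj T \<one>) = Conj T \<one>"
    using hom_mult[OF Conj_hom one_closed one_closed] by (simp add: tensor_Aut_def units_of_def)
  from carr obtain F where F: "F \<in> carrier ?E" "mult ?E F (Conj T \<one>) = one ?E"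
    by (auto simp: Units_def)
  have obj: "conj_obj T \<one> U = U" if "U \<in> Obj T" for U
  proof -
    have "fst F (conj_obj T \<one> V) = V" if "V \<in> Obj T" for V
    proof -
      have "compose (Obj T) (fst F) (conj_obj T \<one>) V = (\<lambda>U \<in> Obj T. U) V"
        using F(2) by (simp add: tensor_End_def conj_obj_def)
      then show ?thesis using that by (simp add: compose_def)
    qed
    then show ?thesis using that
      by (metis conj_obj_closed conj_obj_conj_obj one_closed r_one)
  qed
  have arr: "conj_arr T \<one> f = f" if "f \<in> Arr T" for f
  proof -
    have "snd F (conj_arr T \<one> g) = g" if "g \<in> Arr T" for g
    proof -
      have "compose (Arr T) (snd F) (conj_arr T \<one>) g = (\<lambda>f \<in> Arr T. f) g"
        using F(2) by (simp add: tensor_End_def conj_arr_def)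
      then show ?thesis using that by (simp add: compose_def)
    qed
    then show ?thesis using that
      by (metis conj_arr_closed conj_arr_conj_arr one_closed r_one)
  qed
  show ?thesis
    using Conj_functor(2,3)[OF one_closed] obj arr
    by (auto simp: prod_eq_iff conj_obj_def conj_arr_def fun_eq_iff extensional_def)
qed

lemma conj_one [simp]:
  "U \<in> Obj T \<Longrightarrow> conj_obj T \<one> U = U"
  "f \<in> Arr T \<Longrightarrow> conj_arr T \<one> f = f"
  by (simp_all add: conj_obj_def conj_arr_def Conj_one)

lemma is_iso_conj_arr:
  assumes "\<beta> \<in> carrier G" "is_iso T f"
  shows "is_iso T (conj_arr T \<beta> f)"
proof -
  from assms(2) obtain g where g: "f \<in> Arr T" "g \<in> Arr T" "Dom T g = Cod T f"
    "Cod T g = Dom T f" "g \<bullet>\<^sub>T f = Idt T (Dom T f)" "f \<bullet>\<^sub>T g = Idt T (Cod T f)"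
    by (rule is_isoE)
  show ?thesis
    by (rule is_isoI[of _ "conj_arr T \<beta> g"])
      (use assms(1) g in \<open>simp_all flip: conj_arr_Comp\<close>)
qed

lemma inv_mult_cancel [simp]:
  "\<lbrakk>x \<in> carrier G; y \<in> carrier G\<rbrakk> \<Longrightarrow> inv x \<otimes> (x \<otimes> y) = y"
  "\<lbrakk>x \<in> carrier G; y \<in> carrier G\<rbrakk> \<Longrightarrow> x \<otimes> (inv x \<otimes> y) = y"
  by (simp_all flip: m_assoc)

end

section \<open>Double braidings\<close>

context braided_T_category
begin

lemma Braid_typing [simp]:
  assumes "U \<in> Obj T" "V \<in> Obj T"
  shows "Braid T U V \<in> Arr T" "Dom T (Braid T U V) = U \<boxtimes>\<^sub>T V"
    "Cod T (Braid T U V) = conj_obj T (deg U) V \<boxtimes>\<^sub>T U"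
  using Braid_closed[OF assms] by (simp_all add: Hom_iff act_obj_def)

declare Braid_Conj [simp]

lemma Braid_natural_Arr:
  assumes "f \<in> Arr T" "g \<in> Arr T"
  shows "Braid T (Cod T f) (Cod T g) \<bullet>\<^sub>T (f \<boxdot>\<^sub>T g) =
    (conj_arr T (deg (Dom T f)) g \<boxdot>\<^sub>T f) \<bullet>\<^sub>T Braid T (Dom T f) (Dom T g)"
  using Braid_natural[of "deg (Dom T f)" "Dom T f" "Cod T f" f g "Dom T g" "Cod T g"] assms
  by (simp add: Hom_iff Component_iff degree_Cod)

text \<open>The hexagons at I \<otimes> I = I become idempotency statements only because ^I U = U,
  by \<open>degree_Unit\<close> and \<open>conj_one\<close>, and ^U I = I, by strictness of
  conjugation.\<close>

lemma Braid_Unit [simp]: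
  assumes "U \<in> Obj T"
  shows "Braid T (Unit_obj T) U = Idt T U" "Braid T U (Unit_obj T) = Idt T U"
proof -
  let ?I = "Unit_obj T"
  have "Braid T ?I U \<bullet>\<^sub>T Braid T ?I U = Braid T ?I U"
    using Braid_Tens_left[of ?I ?I U] assms by (simp add: act_obj_def)
  then show "Braid T ?I U = Idt T U"
    using idempotent_iso_eq_Idt[OF Braid_iso[of ?I U]] assms by simp
  have "Braid T U ?I \<bullet>\<^sub>T Braid T U ?I = Braid T U ?I"
    using Braid_Tens_right[of U ?I ?I] assms by (simp add: act_obj_def)
  then show "Braid T U ?I = Idt T U"
    using idempotent_iso_eq_Idt[OF Braid_iso[of U ?I]] assms by simp
qed

definition monodromy where
  "monodromy U V = Braid T (conj_obj T (deg U) V) U \<bullet>\<^sub>T Braid T U V"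

lemma monodromy_typing [simp]:
  assumes "U \<in> Obj T" "V \<in> Obj T"
  shows "monodromy U V \<in> Arr T" "Dom T (monodromy U V) = U \<boxtimes>\<^sub>T V"
    "Cod T (monodromy U V) =
      conj_obj T (deg U \<otimes> deg V \<otimes> inv deg U) U \<boxtimes>\<^sub>T conj_obj T (deg U) V"
  using assms by (simp_all add: monodromy_def)

lemma is_iso_monodromy: "\<lbrakk>U \<in> Obj T; V \<in> Obj T\<rbrakk> \<Longrightarrow> is_iso T (monodromy U V)"
  by (simp add: monodromy_def is_iso_Comp Braid_iso)

lemma conj_arr_monodromy [simp]:
  "\<lbrakk>\<beta> \<in> carrier G; U \<in> Obj T; V \<in> Obj T\<rbrakk>
    \<Longrightarrow> conj_arr T \<beta> (monodromy U V) = monodromy (conj_obj T \<beta> U) (conj_obj T \<beta> V)"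
  by (simp add: monodromy_def m_assoc)

text \<open>Two naturality squares of the braiding, pasted. Passing the first crossing, g acquires
  the degree a of the source of f; passing the second, f acquires the degree a b a^-1 of the
  conjugated source of g.\<close>

lemma monodromy_natural:
  assumes "f \<in> Arr T" "g \<in> Arr T"
  shows "monodromy (Cod T f) (Cod T g) \<bullet>\<^sub>T (f \<boxdot>\<^sub>T g) =
    (conj_arr T (deg (Dom T f) \<otimes> deg (Dom T g) \<otimes> inv deg (Dom T f)) f \<boxdot>\<^sub>T
     conj_arr T (deg (Dom T f)) g) \<bullet>\<^sub>T monodromy (Dom T f) (Dom T g)"
proof -
  let ?\<alpha> = "deg (Dom T f)"
  have "monodromy (Cod T f) (Cod T g) \<bullet>\<^sub>T (f \<boxdot>\<^sub>T g) =
    Braid T (conj_obj T ?\<alpha> (Cod T g)) (Cod T f) \<bullet>\<^sub>T (Braid T (Cod T f) (Cod T g) \<bullet>\<^sub>T (f \<boxdot>\<^sub>T g))"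
    using assms by (simp add: monodromy_def Comp_assoc_Arr degree_Cod)
  also have "\<dots> = (Braid T (Cod T (conj_arr T ?\<alpha> g)) (Cod T f) \<bullet>\<^sub>T (conj_arr T ?\<alpha> g \<boxdot>\<^sub>T f)) \<bullet>\<^sub>T
      Braid T (Dom T f) (Dom T g)"
    using assms by (simp add: Braid_natural_Arr Comp_assoc_Arr degree_Cod)
  also have "\<dots> = (conj_arr T (?\<alpha> \<otimes> deg (Dom T g) \<otimes> inv ?\<alpha>) f \<boxdot>\<^sub>T conj_arr T ?\<alpha> g) \<bullet>\<^sub>T
      monodromy (Dom T f) (Dom T g)"
    \<comment> \<open>The instance is unfolded by hand: the simplifier would first evaluate the
      codomain of the conjugated arrow, and the left side of naturality would no longer
      match.\<close>
    unfolding Braid_natural_Arr[OF conj_arr_closed[OF degree_closed[OF Dom_closed[OF assms(1)]] assms(2)] assms(1)]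
    using assms by (simp add: monodromy_def Comp_assoc_Arr)
  finally show ?thesis .
qed

text \<open>
  Both sides are the full twist on three strands; by naturality every crossing can be
  moved past the braiding with the remaining strand.
\<close>

lemma monodromy_assoc:
  assumes [simp]: "P \<in> Obj T" "Q \<in> Obj T" "R \<in> Obj T"
  shows "monodromy (Cod T (monodromy P Q)) R \<bullet>\<^sub>T (monodromy P Q \<boxdot>\<^sub>T Idt T R) =
    monodromy P (Cod T (monodromy Q R)) \<bullet>\<^sub>T (Idt T P \<boxdot>\<^sub>T monodromy Q R)"
proof -
  let ?\<alpha> = "deg P" and ?\<beta> = "deg Q"
  \<comment> \<open>The objects ^P Q, ^P R and ^(P \<otimes> Q) R. Conjugates of them arise under
    several exponents, for instance ^Q' R' is again \<open>S\<close>; the rules \<open>act\<close>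
    give each a single spelling.\<close>
  define Q' R' S where "Q' = conj_obj T ?\<alpha> Q" and "R' = conj_obj T ?\<alpha> R"
    and "S = conj_obj T (?\<alpha> \<otimes> ?\<beta>) R"
  let ?\<sigma> = "deg S"
  have [simp]: "Q' \<in> Obj T" "R' \<in> Obj T" "S \<in> Obj T"
    and act [simp]: "conj_obj T ?\<alpha> Q = Q'" "conj_obj T ?\<alpha> R = R'"
      "conj_obj T (?\<alpha> \<otimes> ?\<beta>) R = S" "conj_obj T (deg Q') R' = S"
      "conj_obj T (deg Q' \<otimes> ?\<alpha>) R = S"
      "conj_obj T (?\<sigma> \<otimes> ?\<alpha> \<otimes> inv ?\<sigma> \<otimes> ?\<sigma>) Q = conj_obj T ?\<sigma> Q'"
    and deg_Q': "deg Q' \<otimes> deg R' \<otimes> inv deg Q' = ?\<sigma>"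
    and deg_PQ: "?\<alpha> \<otimes> ?\<beta> \<otimes> deg R \<otimes> inv (?\<alpha> \<otimes> ?\<beta>) = ?\<sigma>"
    by (simp_all add: Q'_def R'_def S_def m_assoc inv_mult_group)
  let ?b = "Braid T P Q" and ?M = "monodromy Q' R'"
    and ?c = "Braid T (conj_obj T ?\<sigma> Q') (conj_obj T ?\<sigma> P)"
  let ?X = "(?c \<boxdot>\<^sub>T Idt T S)"
  have "monodromy (Cod T (monodromy P Q)) R \<bullet>\<^sub>T (monodromy P Q \<boxdot>\<^sub>T Idt T R) =
    (conj_arr T ?\<sigma> (monodromy P Q) \<boxdot>\<^sub>T Idt T S) \<bullet>\<^sub>T monodromy (P \<boxtimes>\<^sub>T Q) R"
    \<comment> \<open>The double braiding of P and Q slides past the one with R and comes out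
      conjugated by the degree of \<open>S\<close>. The codomain rule is off so that naturality
      finds \<open>Cod T (monodromy P Q)\<close> as it stands.\<close>
    using monodromy_natural[of "monodromy P Q" "Idt T R"]
    by (simp del: monodromy_typing(3) conj_arr_monodromy add: deg_PQ)
  also have "\<dots> = ?X \<bullet>\<^sub>T ((conj_arr T ?\<sigma> ?b \<boxdot>\<^sub>T Idt T S) \<bullet>\<^sub>T Braid T S (P \<boxtimes>\<^sub>T Q)) \<bullet>\<^sub>T
      Braid T (P \<boxtimes>\<^sub>T Q) R"
    by (simp add: monodromy_def whisker_right Comp_assoc_Arr)
  also have "(conj_arr T ?\<sigma> ?b \<boxdot>\<^sub>T Idt T S) \<bullet>\<^sub>T Braid T S (P \<boxtimes>\<^sub>T Q) =
      Braid T S (Q' \<boxtimes>\<^sub>T P) \<bullet>\<^sub>T (Idt T S \<boxdot>\<^sub>T ?b)"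
    using Braid_natural_Arr[of "Idt T S" ?b] by simp
  also have "?X \<bullet>\<^sub>T (Braid T S (Q' \<boxtimes>\<^sub>T P) \<bullet>\<^sub>T (Idt T S \<boxdot>\<^sub>T ?b)) \<bullet>\<^sub>T Braid T (P \<boxtimes>\<^sub>T Q) R =
      ?X \<bullet>\<^sub>T Braid T S (Q' \<boxtimes>\<^sub>T P) \<bullet>\<^sub>T (Idt T S \<boxdot>\<^sub>T ?b) \<bullet>\<^sub>T Braid T (P \<boxtimes>\<^sub>T Q) R"
    by (simp add: Comp_assoc_Arr)
  also have "(Idt T S \<boxdot>\<^sub>T ?b) \<bullet>\<^sub>T Braid T (P \<boxtimes>\<^sub>T Q) R =
      Braid T (Q' \<boxtimes>\<^sub>T P) R \<bullet>\<^sub>T (?b \<boxdot>\<^sub>T Idt T R)"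
    using Braid_natural_Arr[of ?b "Idt T R"] by simp
  \<comment> \<open>Opening both hexagons brings the crossings of Q' with R' and of \<open>S\<close>
    with Q' next to each other, where they form \<open>?M\<close>. The crossings on either side of
    \<open>?M\<close> are then closed up again, by the other two hexagon instances, into braidings
    with P alone.\<close>
  also have "?X \<bullet>\<^sub>T Braid T S (Q' \<boxtimes>\<^sub>T P) \<bullet>\<^sub>T Braid T (Q' \<boxtimes>\<^sub>T P) R \<bullet>\<^sub>T (?b \<boxdot>\<^sub>T Idt T R) =
      (?X \<bullet>\<^sub>T (Idt T (conj_obj T ?\<sigma> Q') \<boxdot>\<^sub>T Braid T S P)) \<bullet>\<^sub>T (?M \<boxdot>\<^sub>T Idt T P) \<bullet>\<^sub>T
      ((Idt T Q' \<boxdot>\<^sub>T Braid T P R) \<bullet>\<^sub>T (?b \<boxdot>\<^sub>T Idt T R))"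
    by (simp add: Braid_Tens_left[of Q' P R] Braid_Tens_right[of S Q' P] act_obj_def
        monodromy_def whisker_right Comp_assoc_Arr Tens_obj_assoc)
  also have "(Idt T Q' \<boxdot>\<^sub>T Braid T P R) \<bullet>\<^sub>T (?b \<boxdot>\<^sub>T Idt T R) = Braid T P (Q \<boxtimes>\<^sub>T R)"
    by (simp add: Braid_Tens_right act_obj_def)
  also have "?X \<bullet>\<^sub>T (Idt T (conj_obj T ?\<sigma> Q') \<boxdot>\<^sub>T Braid T S P) = Braid T (Cod T ?M) P"
    by (simp add: Braid_Tens_left act_obj_def deg_Q')
  also have "Braid T (Cod T ?M) P \<bullet>\<^sub>T (?M \<boxdot>\<^sub>T Idt T P) \<bullet>\<^sub>T Braid T P (Q \<boxtimes>\<^sub>T R) =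
     (Braid T (Cod T ?M) P \<bullet>\<^sub>T (?M \<boxdot>\<^sub>T Idt T P)) \<bullet>\<^sub>T Braid T P (Q \<boxtimes>\<^sub>T R)"
    by (simp add: Comp_assoc_Arr Tens_obj_assoc)
  also have "Braid T (Cod T ?M) P \<bullet>\<^sub>T (?M \<boxdot>\<^sub>T Idt T P) =
     (Idt T (conj_obj T (deg Q' \<otimes> deg R') P) \<boxdot>\<^sub>T ?M) \<bullet>\<^sub>T Braid T (Q' \<boxtimes>\<^sub>T R') P"
    using Braid_natural_Arr[of ?M "Idt T P"] by (simp del: monodromy_typing(3))
  also have "((Idt T (conj_obj T (deg Q' \<otimes> deg R') P) \<boxdot>\<^sub>T ?M) \<bullet>\<^sub>T Braid T (Q' \<boxtimes>\<^sub>T R') P) \<bullet>\<^sub>T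
     Braid T P (Q \<boxtimes>\<^sub>T R) = (Idt T (conj_obj T (deg Q' \<otimes> deg R') P) \<boxdot>\<^sub>T ?M) \<bullet>\<^sub>T monodromy P (Q \<boxtimes>\<^sub>T R)"
    by (simp add: monodromy_def[of P] Comp_assoc_Arr Tens_obj_assoc)
  \<comment> \<open>Conjugation by deg P turns D(Q,R) into D(Q',R'), which is \<open>?M\<close>;
    this is naturality in the second argument, read backwards.\<close>
  also have "\<dots> = monodromy P (Cod T (monodromy Q R)) \<bullet>\<^sub>T (Idt T P \<boxdot>\<^sub>T monodromy Q R)"
    using monodromy_natural[of "Idt T P" "monodromy Q R"]
    by (simp del: monodromy_typing(3) act add: Q'_def R'_def m_assoc inv_mult_group)
  finally show ?thesis .
qed

section \<open>Objects and arrows of the twist extension\<close>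

abbreviation Z where "Z \<equiv> twist_extension G T"

lemma Z_Obj_iff:
  "X \<in> Z_Obj G T \<longleftrightarrow> fst X \<in> Obj T \<and> snd X \<in> Arr T \<and> Dom T (snd X) = fst X \<and>
    Cod T (snd X) = conj_obj T (deg (fst X)) (fst X) \<and> is_iso T (snd X)"
  by (auto simp: Z_Obj_def Hom_iff act_obj_def)

lemma Z_Arr_iff:
  "(X, f, Y) \<in> Z_Arr G T \<longleftrightarrow> X \<in> Z_Obj G T \<and> Y \<in> Z_Obj G T \<and> f \<in> Arr T \<and>
    Dom T f = fst X \<and> Cod T f = fst Y \<and> conj_arr T (deg (fst X)) f \<bullet>\<^sub>T snd X = snd Y \<bullet>\<^sub>T f"
  by (cases X; cases Y) (auto simp: Z_Arr_def Hom_iff act_arr_def)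

lemma Z_Arr_degree: "(X, f, Y) \<in> Z_Arr G T \<Longrightarrow> deg (fst Y) = deg (fst X)"
  using degree_Cod[of f] by (auto simp: Z_Arr_iff)

lemma Z_Obj_typing:
  assumes "X \<in> Z_Obj G T"
  shows "fst X \<in> Obj T" "snd X \<in> Arr T" "Dom T (snd X) = fst X"
    "Cod T (snd X) = conj_obj T (deg (fst X)) (fst X)"
  using assms by (simp_all add: Z_Obj_iff)

lemma Z_Arr_typing:
  assumes "(X, f, Y) \<in> Z_Arr G T"
  shows "X \<in> Z_Obj G T" "Y \<in> Z_Obj G T" "f \<in> Arr T" "Dom T f = fst X" "Cod T f = fst Y"
  using assms by (simp_all add: Z_Arr_iff)

lemma Z_Arr_twist_compat:
  "(X, f, Y) \<in> Z_Arr G T \<Longrightarrow> conj_arr T (deg (fst X)) f \<bullet>\<^sub>T snd X = snd Y \<bullet>\<^sub>T f"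
  by (simp add: Z_Arr_iff)

lemma Z_conj_obj_sel [simp]:
  "fst (Z_conj_obj T \<beta> X) = conj_obj T \<beta> (fst X)"
  "snd (Z_conj_obj T \<beta> X) = conj_arr T \<beta> (snd X)"
  by (simp_all add: Z_conj_obj_def split_beta)

lemma Z_conj_arr_triple [simp]:
  "Z_conj_arr T \<beta> (X, f, Y) = (Z_conj_obj T \<beta> X, conj_arr T \<beta> f, Z_conj_obj T \<beta> Y)"
  by (simp add: Z_conj_arr_def)

text \<open>In the definition, ^(U \<otimes> V) V equals ^a (^b V), and ^a U has degree a; so the
  two braidings there form one double braiding of ^a U and ^b V.\<close>

lemma Z_tens_sel:
  assumes "X \<in> Z_Obj G T" "Y \<in> Z_Obj G T"
  shows "fst (Z_tens G T X Y) = fst X \<boxtimes>\<^sub>T fst Y"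
    "snd (Z_tens G T X Y) =
      monodromy (conj_obj T (deg (fst X)) (fst X)) (conj_obj T (deg (fst Y)) (fst Y)) \<bullet>\<^sub>T
      (snd X \<boxdot>\<^sub>T snd Y)"
  using assms
  by (auto simp: Z_tens_def split_beta act_obj_def Z_Obj_iff monodromy_def Comp_assoc_Arr m_assoc)

lemma Z_tens_closed [simp]:
  assumes "X \<in> Z_Obj G T" "Y \<in> Z_Obj G T"
  shows "Z_tens G T X Y \<in> Z_Obj G T"
  using assms unfolding Z_Obj_iff[of "Z_tens G T X Y"] Z_tens_sel[OF assms]
  by (auto simp: Z_Obj_iff m_assoc is_iso_monodromy is_iso_Comp is_iso_Tens)

lemma Z_Unit_closed [simp]: "(Unit_obj T, Idt T (Unit_obj T)) \<in> Z_Obj G T"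
  by (simp add: Z_Obj_iff is_iso_Idt)

text \<open>The conjugated object has degree \<beta> a \<beta>^-1, and conjugating ^\<beta> U by it
  gives ^(\<beta> a) U, the codomain of the conjugated twist.\<close>

lemma Z_conj_obj_closed [simp]:
  "\<lbrakk>\<beta> \<in> carrier G; X \<in> Z_Obj G T\<rbrakk> \<Longrightarrow> Z_conj_obj T \<beta> X \<in> Z_Obj G T"
  by (auto simp: Z_Obj_iff is_iso_conj_arr m_assoc)

lemma Z_tens_Unit [simp]:
  assumes "X \<in> Z_Obj G T"
  shows "Z_tens G T (Unit_obj T, Idt T (Unit_obj T)) X = X"
    "Z_tens G T X (Unit_obj T, Idt T (Unit_obj T)) = X"
  using assms by (intro prod_eqI; simp add: Z_tens_sel; simp add: Z_Obj_iff monodromy_def)+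

lemma Z_tens_assoc:
  assumes "X \<in> Z_Obj G T" "Y \<in> Z_Obj G T" "W \<in> Z_Obj G T"
  shows "Z_tens G T (Z_tens G T X Y) W = Z_tens G T X (Z_tens G T Y W)"
proof (rule prod_eqI)
  let ?t = "snd X" and ?s = "snd Y" and ?r = "snd W"
  let ?P = "Cod T ?t" and ?Q = "Cod T ?s" and ?R = "Cod T ?r"
  note [simp] = assms[unfolded Z_Obj_iff, THEN conjunct1]
    assms[unfolded Z_Obj_iff, THEN conjunct2, THEN conjunct1]
    assms[unfolded Z_Obj_iff, THEN conjunct2, THEN conjunct2, THEN conjunct1]
  have Cod: "conj_obj T (deg (fst X)) (fst X) = ?P" "conj_obj T (deg (fst Y)) (fst Y) = ?Q"
    "conj_obj T (deg (fst W)) (fst W) = ?R"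
    using assms by (simp_all add: Z_Obj_iff)
  have deg [simp]: "deg ?P = deg (fst X)" "deg ?Q = deg (fst Y)" "deg ?R = deg (fst W)"
    by (simp_all add: degree_Cod)
  show "fst (Z_tens G T (Z_tens G T X Y) W) = fst (Z_tens G T X (Z_tens G T Y W))"
    using assms by (simp add: Z_tens_sel Tens_obj_assoc)
  \<comment> \<open>The twist of the inner product ends in \<open>Cod T (monodromy ?P ?Q)\<close>,
    so this object is an argument of the outer double braiding. Moving the three given twists to the
    right leaves exactly the left side of \<open>monodromy_assoc\<close>.\<close>
  have "snd (Z_tens G T (Z_tens G T X Y) W) =
      monodromy (Cod T (monodromy ?P ?Q)) ?R \<bullet>\<^sub>T ((monodromy ?P ?Q \<bullet>\<^sub>T (?t \<boxdot>\<^sub>T ?s)) \<boxdot>\<^sub>T ?r)"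
    using assms by (simp add: Z_tens_sel Cod m_assoc flip: Cod)
  also have "\<dots> = (monodromy (Cod T (monodromy ?P ?Q)) ?R \<bullet>\<^sub>T (monodromy ?P ?Q \<boxdot>\<^sub>T Idt T ?R)) \<bullet>\<^sub>T
      (?t \<boxdot>\<^sub>T ?s \<boxdot>\<^sub>T ?r)"
    by (simp del: monodromy_typing(3) add: Comp_assoc_Arr interchange flip: Tens_arr_assoc)
  also have "\<dots> = (monodromy ?P (Cod T (monodromy ?Q ?R)) \<bullet>\<^sub>T (Idt T ?P \<boxdot>\<^sub>T monodromy ?Q ?R)) \<bullet>\<^sub>T
      (?t \<boxdot>\<^sub>T ?s \<boxdot>\<^sub>T ?r)"
    by (subst monodromy_assoc) simp_all
  also have "\<dots> = monodromy ?P (Cod T (monodromy ?Q ?R)) \<bullet>\<^sub>T (?t \<boxdot>\<^sub>T (monodromy ?Q ?R \<bullet>\<^sub>T (?s \<boxdot>\<^sub>T ?r)))"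
    by (simp del: monodromy_typing(3) add: Comp_assoc_Arr interchange)
  also have "\<dots> = snd (Z_tens G T X (Z_tens G T Y W))"
    using assms by (simp add: Z_tens_sel Cod m_assoc flip: Cod)
  finally show "snd (Z_tens G T (Z_tens G T X Y) W) = snd (Z_tens G T X (Z_tens G T Y W))" .
qed

lemma Z_conj_obj_tens:
  assumes "\<beta> \<in> carrier G" "X \<in> Z_Obj G T" "Y \<in> Z_Obj G T"
  shows "Z_conj_obj T \<beta> (Z_tens G T X Y) = Z_tens G T (Z_conj_obj T \<beta> X) (Z_conj_obj T \<beta> Y)"
  using assms
  by (intro prod_eqI) (simp_all add: Z_tens_sel, auto simp: Z_Obj_iff m_assoc)

section \<open>Closure of the arrows of the extension under the structure\<close>

lemma Z_Arr_Idt: "X \<in> Z_Obj G T \<Longrightarrow> (X, Idt T (fst X), X) \<in> Z_Arr G T"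
  by (auto simp: Z_Arr_iff Z_Obj_iff)

lemma Z_Arr_Comp:
  assumes "(X, f, Y) \<in> Z_Arr G T" "(Y, g, W) \<in> Z_Arr G T"
  shows "(X, g \<bullet>\<^sub>T f, W) \<in> Z_Arr G T"
proof -
  note d = Z_Arr_degree[OF assms(1)]
  note A = Z_Arr_typing[OF assms(1)] Z_Arr_typing[OF assms(2)]
  note O = Z_Obj_typing[OF A(1)] Z_Obj_typing[OF A(2)] Z_Obj_typing[OF A(7)]
  have "conj_arr T (deg (fst X)) (g \<bullet>\<^sub>T f) \<bullet>\<^sub>T snd X =
      conj_arr T (deg (fst X)) g \<bullet>\<^sub>T (conj_arr T (deg (fst X)) f \<bullet>\<^sub>T snd X)"
    using A O by (simp add: Comp_assoc_Arr)
  also have "\<dots> = (conj_arr T (deg (fst Y)) g \<bullet>\<^sub>T snd Y) \<bullet>\<^sub>T f"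
    unfolding Z_Arr_twist_compat[OF assms(1)] using A O d by (simp add: Comp_assoc_Arr)
  also have "\<dots> = snd W \<bullet>\<^sub>T (g \<bullet>\<^sub>T f)"
    unfolding Z_Arr_twist_compat[OF assms(2)] using A O d
      Z_Arr_degree[OF assms(2)] by (simp add: Comp_assoc_Arr)
  finally show ?thesis using A O by (simp add: Z_Arr_iff)
qed

lemma Z_Arr_Tens:
  assumes "(X, f, Y) \<in> Z_Arr G T" "(X', f', Y') \<in> Z_Arr G T"
  shows "(Z_tens G T X X', f \<boxdot>\<^sub>T f', Z_tens G T Y Y') \<in> Z_Arr G T"
proof -
  note d = Z_Arr_degree[OF assms(1)] Z_Arr_degree[OF assms(2)]
  note A = assms[unfolded Z_Arr_iff Z_Obj_iff]
  have Obj: "X \<in> Z_Obj G T" "Y \<in> Z_Obj G T" "X' \<in> Z_Obj G T" "Y' \<in> Z_Obj G T"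
    using assms by (simp_all add: Z_Arr_iff)
  let ?\<alpha> = "deg (fst X)" and ?\<beta> = "deg (fst X')"
  let ?f = "conj_arr T ?\<alpha> f" and ?f' = "conj_arr T ?\<beta> f'"
  \<comment> \<open>Naturality is taken at the conjugated arrows because the twists end in
    conjugated objects. On the first factor the exponent \<alpha> \<beta> \<alpha>^-1 meets the
    \<alpha> already present, so both factors end up conjugated by \<alpha> \<beta>.\<close>
  have nat: "monodromy (Cod T ?f) (Cod T ?f') \<bullet>\<^sub>T (?f \<boxdot>\<^sub>T ?f') =
      conj_arr T (?\<alpha> \<otimes> ?\<beta>) (f \<boxdot>\<^sub>T f') \<bullet>\<^sub>T monodromy (Dom T ?f) (Dom T ?f')"
    using monodromy_natural[of ?f ?f'] A by (simp add: m_assoc)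
  have "conj_arr T (?\<alpha> \<otimes> ?\<beta>) (f \<boxdot>\<^sub>T f') \<bullet>\<^sub>T snd (Z_tens G T X X') =
      (conj_arr T (?\<alpha> \<otimes> ?\<beta>) (f \<boxdot>\<^sub>T f') \<bullet>\<^sub>T monodromy (Dom T ?f) (Dom T ?f')) \<bullet>\<^sub>T (snd X \<boxdot>\<^sub>T snd X')"
    using A Obj by (simp add: Z_tens_sel Comp_assoc_Arr m_assoc)
  also have "\<dots> = monodromy (Cod T ?f) (Cod T ?f') \<bullet>\<^sub>T ((?f \<bullet>\<^sub>T snd X) \<boxdot>\<^sub>T (?f' \<bullet>\<^sub>T snd X'))"
    unfolding nat[symmetric] using A by (simp add: Comp_assoc_Arr interchange)
  also have "\<dots> = monodromy (Cod T ?f) (Cod T ?f') \<bullet>\<^sub>T ((snd Y \<bullet>\<^sub>T f) \<boxdot>\<^sub>T (snd Y' \<bullet>\<^sub>T f'))"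
    using A by simp
  also have "\<dots> = snd (Z_tens G T Y Y') \<bullet>\<^sub>T (f \<boxdot>\<^sub>T f')"
    using A Obj d by (simp add: Z_tens_sel Comp_assoc_Arr interchange)
  finally show ?thesis using A Obj by (simp add: Z_Arr_iff Z_tens_sel)
qed

lemma Z_Arr_conj:
  assumes "\<beta> \<in> carrier G" "(X, f, Y) \<in> Z_Arr G T"
  shows "(Z_conj_obj T \<beta> X, conj_arr T \<beta> f, Z_conj_obj T \<beta> Y) \<in> Z_Arr G T"
proof -
  note A = Z_Arr_typing[OF assms(2)]
  note O = Z_Obj_typing[OF A(1)] Z_Obj_typing[OF A(2)]
  have "conj_arr T (\<beta> \<otimes> deg (fst X)) f \<bullet>\<^sub>T conj_arr T \<beta> (snd X) =
      conj_arr T \<beta> (conj_arr T (deg (fst X)) f \<bullet>\<^sub>T snd X)"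
    using A O assms(1) by simp
  also have "\<dots> = conj_arr T \<beta> (snd Y) \<bullet>\<^sub>T conj_arr T \<beta> f"
    unfolding Z_Arr_twist_compat[OF assms(2)] using A O assms(1) by simp
  finally show ?thesis
    using A O assms(1) by (simp add: Z_Arr_iff m_assoc)
qed

text \<open>Put P = ^a U and Q = ^b V. The twist of X \<odot> Y contributes the crossings c_{P,Q}
  and then c_{^a Q,P}; the conjugate of c_{U,V} by ab adds a third. The last two are the double
  braiding in the twist of ^a Y \<odot> X, and the first passes the two given twists by
  naturality.\<close>

lemma Z_Arr_Braid:
  assumes "X \<in> Z_Obj G T" "Y \<in> Z_Obj G T"
  shows "(Z_tens G T X Y, Braid T (fst X) (fst Y),
    Z_tens G T (Z_conj_obj T (deg (fst X)) Y) X) \<in> Z_Arr G T"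
proof -
  note A = assms[unfolded Z_Obj_iff]
  let ?\<alpha> = "deg (fst X)" and ?\<beta> = "deg (fst Y)"
  let ?P = "conj_obj T ?\<alpha> (fst X)" and ?Q = "conj_obj T ?\<beta> (fst Y)"
  have Obj: "Z_conj_obj T ?\<alpha> Y \<in> Z_Obj G T"
    using A assms by simp
  have "conj_arr T (?\<alpha> \<otimes> ?\<beta>) (Braid T (fst X) (fst Y)) \<bullet>\<^sub>T snd (Z_tens G T X Y) =
      monodromy (conj_obj T (?\<alpha> \<otimes> ?\<beta>) (fst Y)) ?P \<bullet>\<^sub>T (Braid T ?P ?Q \<bullet>\<^sub>T (snd X \<boxdot>\<^sub>T snd Y))"
    using A assms by (simp add: Z_tens_sel monodromy_def Comp_assoc_Arr m_assoc inv_mult_group)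
  also have "Braid T ?P ?Q \<bullet>\<^sub>T (snd X \<boxdot>\<^sub>T snd Y) =
      (conj_arr T ?\<alpha> (snd Y) \<boxdot>\<^sub>T snd X) \<bullet>\<^sub>T Braid T (fst X) (fst Y)"
    using Braid_natural_Arr[of "snd X" "snd Y"] A by simp
  also have "monodromy (conj_obj T (?\<alpha> \<otimes> ?\<beta>) (fst Y)) ?P \<bullet>\<^sub>T \<dots> =
      snd (Z_tens G T (Z_conj_obj T ?\<alpha> Y) X) \<bullet>\<^sub>T Braid T (fst X) (fst Y)"
    using A assms Obj by (simp add: Z_tens_sel Comp_assoc_Arr m_assoc)
  finally show ?thesis
    using A assms Obj by (simp add: Z_Arr_iff Z_tens_sel)
qed

text \<open>The target carries the twist ^a t, so both sides of the compatibility condition are the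
  composite of ^a t with t.\<close>

lemma Z_Arr_Twist:
  "X \<in> Z_Obj G T \<Longrightarrow> (X, snd X, Z_conj_obj T (deg (fst X)) X) \<in> Z_Arr G T"
  by (auto simp: Z_Arr_iff Z_Obj_iff is_iso_conj_arr m_assoc)

text \<open>Compose the compatibility condition of f with ^a g on the left and g on the right. Thus
  an arrow of the extension is invertible there as soon as it is invertible in
  \<open>T\<close>.\<close>

lemma Z_Arr_inverse:
  assumes "(X, f, Y) \<in> Z_Arr G T" "g \<in> Arr T" "Dom T g = Cod T f" "Cod T g = Dom T f"
    "g \<bullet>\<^sub>T f = Idt T (Dom T f)" "f \<bullet>\<^sub>T g = Idt T (Cod T f)"
  shows "(Y, g, X) \<in> Z_Arr G T"
proof -
  note d = Z_Arr_degree[OF assms(1)]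
  note A = Z_Arr_typing[OF assms(1)]
  note O = Z_Obj_typing[OF A(1)] Z_Obj_typing[OF A(2)]
  let ?\<alpha> = "deg (fst X)"
  have id: "conj_arr T ?\<alpha> g \<bullet>\<^sub>T conj_arr T ?\<alpha> f = Idt T (conj_obj T ?\<alpha> (fst X))"
    using A O assms by (simp flip: conj_arr_Comp)
  have "conj_arr T ?\<alpha> g \<bullet>\<^sub>T snd Y = conj_arr T ?\<alpha> g \<bullet>\<^sub>T (snd Y \<bullet>\<^sub>T f) \<bullet>\<^sub>T g"
    using A O assms d by (simp add: Comp_assoc_Arr)
  also have "\<dots> = (conj_arr T ?\<alpha> g \<bullet>\<^sub>T conj_arr T ?\<alpha> f) \<bullet>\<^sub>T (snd X \<bullet>\<^sub>T g)"
    unfolding Z_Arr_twist_compat[OF assms(1), symmetric]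
    using A O assms(2-4) d by (simp add: Comp_assoc_Arr)
  also have "\<dots> = snd X \<bullet>\<^sub>T g"
    unfolding id using A O assms(2-4) by simp
  finally show ?thesis
    using A assms(2-4) d by (simp add: Z_Arr_iff)
qed

section \<open>The categorical structure of the twist extension\<close>

lemma Z_sel [simp]:
  "Obj Z = Z_Obj G T" "Arr Z = Z_Arr G T"
  "Dom Z (X, f, Y) = X" "Cod Z (X, f, Y) = Y"
  "Idt Z X = (X, Idt T (fst X), X)"
  "Comp Z (Y', g, W) (X, f, Y) = (X, g \<bullet>\<^sub>T f, W)"
  "Tens_obj Z X X' = Z_tens G T X X'"
  "Tens_arr Z (X, f, Y) (X', f', Y') = (Z_tens G T X X', f \<boxdot>\<^sub>T f', Z_tens G T Y Y')"
  "Unit_obj Z = (Unit_obj T, Idt T (Unit_obj T))"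
  "Component Z \<alpha> = {X \<in> Z_Obj G T. fst X \<in> Component T \<alpha>}"
  "Conj Z \<beta> = (restrict (Z_conj_obj T \<beta>) (Z_Obj G T), restrict (Z_conj_arr T \<beta>) (Z_Arr G T))"
  "Braid Z X X' = (Z_tens G T X X', Braid T (fst X) (fst X'),
    Z_tens G T (Z_conj_obj T (deg (fst X)) X') X)"
  "Twist Z X = (X, snd X, Z_conj_obj T (deg (fst X)) X)"
  by (auto simp: twist_extension_def split_beta)

lemma Hom_Z: "F \<in> Hom Z X Y \<longleftrightarrow> (\<exists>f. F = (X, f, Y) \<and> (X, f, Y) \<in> Z_Arr G T)"
  by (cases F) (auto simp: Hom_def)

lemma HomE_Z:
  assumes "F \<in> Hom Z X Y"
  obtains f where "F = (X, f, Y)" "(X, f, Y) \<in> Z_Arr G T" "X \<in> Z_Obj G T" "Y \<in> Z_Obj G T"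
    "f \<in> Arr T" "Dom T f = fst X" "Cod T f = fst Y"
  using assms Z_Arr_typing by (auto simp: Hom_Z)

lemma ArrE_Z:
  assumes "F \<in> Arr Z"
  obtains X f Y where "F = (X, f, Y)" "(X, f, Y) \<in> Z_Arr G T" "X \<in> Z_Obj G T" "Y \<in> Z_Obj G T"
    "f \<in> Arr T" "Dom T f = fst X" "Cod T f = fst Y"
  using assms unfolding Z_sel(2) by (metis Z_Arr_typing prod_cases3)

lemma strict_tensor_category_Z: "strict_tensor_category Z"
proof
  show "Dom Z F \<in> Obj Z" if "F \<in> Arr Z" for F
    using that by (elim ArrE_Z) simp
  show "Cod Z F \<in> Obj Z" if "F \<in> Arr Z" for F
    using that by (elim ArrE_Z) simp
  show "Idt Z X \<in> Hom Z X X" if "X \<in> Obj Z" for X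
    using that by (simp add: Hom_Z Z_Arr_Idt)
  show "F' \<bullet>\<^bsub>Z\<^esub> F \<in> Hom Z X W" if "F \<in> Hom Z X Y" "F' \<in> Hom Z Y W" for F F' X Y W
    using that by (auto simp: Hom_Z Z_Arr_Comp)
  show "Idt Z Y \<bullet>\<^bsub>Z\<^esub> F = F" "F \<bullet>\<^bsub>Z\<^esub> Idt Z X = F" if "F \<in> Hom Z X Y" for F X Y
    using that by (auto elim!: HomE_Z)
  show "(F'' \<bullet>\<^bsub>Z\<^esub> F') \<bullet>\<^bsub>Z\<^esub> F = F'' \<bullet>\<^bsub>Z\<^esub> F' \<bullet>\<^bsub>Z\<^esub> F"
    if "F \<in> Hom Z X Y" "F' \<in> Hom Z Y W" "F'' \<in> Hom Z W V" for F F' F'' X Y W V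
    using that by (auto elim!: HomE_Z simp: Comp_assoc_Arr)
  show "X \<boxtimes>\<^bsub>Z\<^esub> Y \<in> Obj Z" if "X \<in> Obj Z" "Y \<in> Obj Z" for X Y
    using that by simp
  show "F \<boxdot>\<^bsub>Z\<^esub> F' \<in> Hom Z (X \<boxtimes>\<^bsub>Z\<^esub> X') (Y \<boxtimes>\<^bsub>Z\<^esub> Y')"
    if "F \<in> Hom Z X Y" "F' \<in> Hom Z X' Y'" for F F' X Y X' Y'
    using that by (auto simp: Hom_Z Z_Arr_Tens)
  show "Idt Z X \<boxdot>\<^bsub>Z\<^esub> Idt Z Y = Idt Z (X \<boxtimes>\<^bsub>Z\<^esub> Y)" if "X \<in> Obj Z" "Y \<in> Obj Z" for X Y
    using that by (simp add: Z_tens_sel Z_Obj_typing)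
  show "(F' \<bullet>\<^bsub>Z\<^esub> F) \<boxdot>\<^bsub>Z\<^esub> (E' \<bullet>\<^bsub>Z\<^esub> E) = (F' \<boxdot>\<^bsub>Z\<^esub> E') \<bullet>\<^bsub>Z\<^esub> (F \<boxdot>\<^bsub>Z\<^esub> E)"
    if "F \<in> Hom Z X X'" "F' \<in> Hom Z X' X''" "E \<in> Hom Z Y Y'" "E' \<in> Hom Z Y' Y''"
    for F F' E E' X X' X'' Y Y' Y''
    using that by (auto elim!: HomE_Z simp: interchange)
  show "Unit_obj Z \<in> Obj Z"
    by simp
  show "(X \<boxtimes>\<^bsub>Z\<^esub> Y) \<boxtimes>\<^bsub>Z\<^esub> W = X \<boxtimes>\<^bsub>Z\<^esub> Y \<boxtimes>\<^bsub>Z\<^esub> W"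
    if "X \<in> Obj Z" "Y \<in> Obj Z" "W \<in> Obj Z" for X Y W
    using that by (simp add: Z_tens_assoc)
  show "(F \<boxdot>\<^bsub>Z\<^esub> F') \<boxdot>\<^bsub>Z\<^esub> F'' = F \<boxdot>\<^bsub>Z\<^esub> F' \<boxdot>\<^bsub>Z\<^esub> F''"
    if "F \<in> Arr Z" "F' \<in> Arr Z" "F'' \<in> Arr Z" for F F' F''
    using that by (elim ArrE_Z) (simp add: Z_tens_assoc Tens_arr_assoc)
  show "Unit_obj Z \<boxtimes>\<^bsub>Z\<^esub> X = X" "X \<boxtimes>\<^bsub>Z\<^esub> Unit_obj Z = X" if "X \<in> Obj Z" for X
    using that by simp_all
  show "Idt Z (Unit_obj Z) \<boxdot>\<^bsub>Z\<^esub> F = F" "F \<boxdot>\<^bsub>Z\<^esub> Idt Z (Unit_obj Z) = F" if "F \<in> Arr Z" for F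
    using that by (elim ArrE_Z; simp)+
qed

lemma is_iso_Z:
  assumes "(X, f, Y) \<in> Z_Arr G T" "is_iso T f"
  shows "is_iso Z (X, f, Y)"
proof -
  interpret Z: strict_tensor_category Z by (rule strict_tensor_category_Z)
  from assms(2) obtain g where g: "f \<in> Arr T" "g \<in> Arr T" "Dom T g = Cod T f"
    "Cod T g = Dom T f" "g \<bullet>\<^sub>T f = Idt T (Dom T f)" "f \<bullet>\<^sub>T g = Idt T (Cod T f)"
    by (rule is_isoE)
  show ?thesis
    by (rule Z.is_isoI[of _ "(Y, g, X)"])
      (use assms(1) g Z_Arr_typing[OF assms(1)] Z_Arr_inverse[OF assms(1) g(2-6)] in auto)
qed

section \<open>Degrees and conjugation functors of the extension\<close>

lemma degree_Z [simp]: "X \<in> Z_Obj G T \<Longrightarrow> degree G Z X = deg (fst X)"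
  by (simp add: degree_def)

lemma conj_Z [simp]:
  "X \<in> Z_Obj G T \<Longrightarrow> conj_obj Z \<beta> X = Z_conj_obj T \<beta> X"
  "F \<in> Z_Arr G T \<Longrightarrow> conj_arr Z \<beta> F = Z_conj_arr T \<beta> F"
  by (simp_all add: conj_obj_def conj_arr_def)

lemma Z_conj_obj_mult:
  "\<lbrakk>\<alpha> \<in> carrier G; \<beta> \<in> carrier G; X \<in> Z_Obj G T\<rbrakk>
    \<Longrightarrow> Z_conj_obj T \<alpha> (Z_conj_obj T \<beta> X) = Z_conj_obj T (\<alpha> \<otimes> \<beta>) X"
  by (intro prod_eqI) (simp_all add: Z_Obj_typing)

lemma Z_conj_obj_one: "X \<in> Z_Obj G T \<Longrightarrow> Z_conj_obj T \<one> X = X"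
  by (intro prod_eqI) (simp_all add: Z_Obj_typing)

lemma Z_conj_arr_closed:
  "\<lbrakk>\<beta> \<in> carrier G; F \<in> Arr Z\<rbrakk> \<Longrightarrow> Z_conj_arr T \<beta> F \<in> Z_Arr G T"
  by (elim ArrE_Z) (simp add: Z_Arr_conj)

lemma Z_conj_arr_mult:
  "\<lbrakk>\<alpha> \<in> carrier G; \<beta> \<in> carrier G; F \<in> Arr Z\<rbrakk>
    \<Longrightarrow> Z_conj_arr T \<alpha> (Z_conj_arr T \<beta> F) = Z_conj_arr T (\<alpha> \<otimes> \<beta>) F"
  by (elim ArrE_Z) (simp add: Z_conj_obj_mult)

lemma Z_conj_arr_one: "F \<in> Arr Z \<Longrightarrow> Z_conj_arr T \<one> F = F"
  by (elim ArrE_Z) (simp add: Z_conj_obj_one)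

lemma strict_tensor_endofunctor_Conj_Z:
  assumes [simp]: "\<beta> \<in> carrier G"
  shows "strict_tensor_endofunctor Z (Conj Z \<beta>)"
  unfolding strict_tensor_endofunctor_def
proof (intro conjI ballI impI)
  show "fst (Conj Z \<beta>) X \<in> Obj Z" if "X \<in> Obj Z" for X
    using that by simp
  show "snd (Conj Z \<beta>) F \<in> Hom Z (fst (Conj Z \<beta>) (Dom Z F)) (fst (Conj Z \<beta>) (Cod Z F))"
    if "F \<in> Arr Z" for F
    using that by (elim ArrE_Z) (simp add: Hom_Z Z_Arr_conj)
  show "snd (Conj Z \<beta>) (Idt Z X) = Idt Z (fst (Conj Z \<beta>) X)" if "X \<in> Obj Z" for X
    using that by (simp add: Z_Arr_Idt Z_Obj_typing)
  show "snd (Conj Z \<beta>) (F' \<bullet>\<^bsub>Z\<^esub> F) = snd (Conj Z \<beta>) F' \<bullet>\<^bsub>Z\<^esub> snd (Conj Z \<beta>) F"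
    if "F \<in> Arr Z" "F' \<in> Arr Z" "Dom Z F' = Cod Z F" for F F'
    using that by (elim ArrE_Z) (simp add: Z_Arr_Comp)
  show "fst (Conj Z \<beta>) (X \<boxtimes>\<^bsub>Z\<^esub> Y) = fst (Conj Z \<beta>) X \<boxtimes>\<^bsub>Z\<^esub> fst (Conj Z \<beta>) Y"
    if "X \<in> Obj Z" "Y \<in> Obj Z" for X Y
    using that by (simp add: Z_conj_obj_tens)
  show "snd (Conj Z \<beta>) (F \<boxdot>\<^bsub>Z\<^esub> F') = snd (Conj Z \<beta>) F \<boxdot>\<^bsub>Z\<^esub> snd (Conj Z \<beta>) F'"
    if "F \<in> Arr Z" "F' \<in> Arr Z" for F F'
    using that by (elim ArrE_Z) (simp add: Z_Arr_Tens Z_conj_obj_tens)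
  show "fst (Conj Z \<beta>) (Unit_obj Z) = Unit_obj Z"
    by (simp add: Z_conj_obj_def)
qed

text \<open>An equality of pairs of functions, available because both sides are restricted to the
  same objects and arrows; closure under conjugation makes the inner restriction invisible.\<close>

lemma mult_Conj_Z:
  assumes "\<alpha> \<in> carrier G" "\<beta> \<in> carrier G"
  shows "Conj Z \<alpha> \<otimes>\<^bsub>tensor_End Z\<^esub> Conj Z \<beta> = Conj Z (\<alpha> \<otimes> \<beta>)"
  using assms
  by (simp add: tensor_End_def compose_def)
    (intro conjI restrict_ext; use Z_conj_arr_closed in \<open>simp add: Z_conj_obj_mult Z_conj_arr_mult\<close>)

lemma Conj_Z_one: "Conj Z \<one> = \<one>\<^bsub>tensor_End Z\<^esub>"
  by (simp add: tensor_End_def)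
    (intro conjI restrict_ext; simp add: Z_conj_obj_one Z_conj_arr_one)

lemma Conj_Z_hom: "Conj Z \<in> hom G (tensor_Aut Z)"
proof -
  have End: "Conj Z \<beta> \<in> carrier (tensor_End Z)" if "\<beta> \<in> carrier G" for \<beta>
    using strict_tensor_endofunctor_Conj_Z[OF that] by (simp add: tensor_End_def)
  have "Conj Z \<beta> \<in> Units (tensor_End Z)" if "\<beta> \<in> carrier G" for \<beta>
    unfolding Units_def using that
    \<comment> \<open>The inverse functor is conjugation by \<open>inv \<beta>\<close>.
      \<open>Conj Z\<close> has to stay folded for \<open>mult_Conj_Z\<close> and
      \<open>Conj_Z_one\<close> to match.\<close>
    by (auto intro!: End bexI[of _ "Conj Z (inv \<beta>)"] simp: mult_Conj_Z Conj_Z_one simp del: Z_sel(11))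
  then show ?thesis
    by (intro homI) (simp_all add: tensor_Aut_def units_of_def mult_Conj_Z del: Z_sel(11))
qed

section \<open>The axioms of a balanced T-category\<close>

lemma T_category_Z: "T_category G Z"
proof (intro T_category.intro T_category_axioms.intro)
  show "group G" by (rule is_group)
  show "strict_tensor_category Z" by (rule strict_tensor_category_Z)
  show "Obj Z = (\<Union>\<alpha>\<in>carrier G. Component Z \<alpha>)"
  proof (rule Set.set_eqI)
    show "X \<in> Obj Z \<longleftrightarrow> X \<in> (\<Union>\<alpha>\<in>carrier G. Component Z \<alpha>)" for X
      using Z_Obj_typing(1)[of X] by (auto simp: Component_iff)
  qed
  show "Arr Z = (\<Union>\<alpha>\<in>carrier G. Component_arr Z \<alpha>)"
  proof (intro equalityI subsetI)
    fix F assume "F \<in> Arr Z"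
    then show "F \<in> (\<Union>\<alpha>\<in>carrier G. Component_arr Z \<alpha>)"
      by (elim ArrE_Z) (simp add: Component_arr_def Component_iff Z_Obj_typing Z_Arr_degree)
  qed (auto simp: Component_arr_def)
  show "Component Z \<alpha> \<inter> Component Z \<beta> = {}"
    if "\<alpha> \<in> carrier G" "\<beta> \<in> carrier G" "\<alpha> \<noteq> \<beta>" for \<alpha> \<beta>
    using Component_disjoint[OF that] by auto
  show "X \<boxtimes>\<^bsub>Z\<^esub> Y \<in> Component Z (\<alpha> \<otimes> \<beta>)"
    if "\<alpha> \<in> carrier G" "\<beta> \<in> carrier G" "X \<in> Component Z \<alpha>" "Y \<in> Component Z \<beta>" for \<alpha> \<beta> X Y
    using that by (auto simp: Component_iff Z_tens_sel)
  show "Conj Z \<in> hom G (tensor_Aut Z)" by (rule Conj_Z_hom)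
  fix \<alpha> \<beta> assume carr [simp]: "\<alpha> \<in> carrier G" "\<beta> \<in> carrier G"
  \<comment> \<open>Serves surjectivity: applying the inclusions \<open>obj\<close> and
    \<open>arr\<close> to \<open>inv \<beta>\<close> and \<beta> \<alpha> \<beta>^-1 gives preimages
    lying in component \<alpha>.\<close>
  have cancel: "inv \<beta> \<otimes> (\<beta> \<otimes> \<alpha> \<otimes> inv \<beta>) \<otimes> inv (inv \<beta>) = \<alpha>"
    by (simp add: m_assoc)
  have obj: "Z_conj_obj T \<gamma> X \<in> Component Z (\<gamma> \<otimes> \<delta> \<otimes> inv \<gamma>)"
    if "\<gamma> \<in> carrier G" "\<delta> \<in> carrier G" "X \<in> Component Z \<delta>" for \<gamma> \<delta> X
    using that by (auto simp: Component_iff)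
  have arr: "Z_conj_arr T \<gamma> F \<in> Component_arr Z (\<gamma> \<otimes> \<delta> \<otimes> inv \<gamma>)"
    if "\<gamma> \<in> carrier G" "\<delta> \<in> carrier G" "F \<in> Component_arr Z \<delta>" for \<gamma> \<delta> F
  proof -
    have "F \<in> Arr Z" using that by (simp add: Component_arr_def)
    then show ?thesis
      by (rule ArrE_Z) (use that in \<open>simp add: Component_arr_def Z_Arr_conj Component_iff\<close>)
  qed
  show "conj_obj Z \<beta> ` Component Z \<alpha> = Component Z (\<beta> \<otimes> \<alpha> \<otimes> inv \<beta>)"
  proof (intro equalityI subsetI)
    fix Y assume "Y \<in> conj_obj Z \<beta> ` Component Z \<alpha>"
    then show "Y \<in> Component Z (\<beta> \<otimes> \<alpha> \<otimes> inv \<beta>)"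
      using obj[of \<beta> \<alpha>] by auto
  next
    fix Y assume Y: "Y \<in> Component Z (\<beta> \<otimes> \<alpha> \<otimes> inv \<beta>)"
    have "Z_conj_obj T (inv \<beta>) Y \<in> Component Z \<alpha>"
      using obj[OF _ _ Y, of "inv \<beta>"] unfolding cancel by simp
    moreover have "Y = conj_obj Z \<beta> (Z_conj_obj T (inv \<beta>) Y)"
      using Y by (simp add: Z_conj_obj_mult Z_conj_obj_one)
    ultimately show "Y \<in> conj_obj Z \<beta> ` Component Z \<alpha>" by (rule rev_image_eqI)
  qed
  show "conj_arr Z \<beta> ` Component_arr Z \<alpha> = Component_arr Z (\<beta> \<otimes> \<alpha> \<otimes> inv \<beta>)"
  proof (intro equalityI subsetI)
    fix F assume "F \<in> conj_arr Z \<beta> ` Component_arr Z \<alpha>"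
    then obtain E where "E \<in> Component_arr Z \<alpha>" "F = Z_conj_arr T \<beta> E"
      by (auto simp: Component_arr_def)
    then show "F \<in> Component_arr Z (\<beta> \<otimes> \<alpha> \<otimes> inv \<beta>)"
      by (simp add: arr del: Z_sel(10))
  next
    fix F assume F: "F \<in> Component_arr Z (\<beta> \<otimes> \<alpha> \<otimes> inv \<beta>)"
    then have Arr: "F \<in> Z_Arr G T" by (simp add: Component_arr_def)
    have "Z_conj_arr T (inv \<beta>) F \<in> Component_arr Z \<alpha>"
      using arr[OF _ _ F, of "inv \<beta>"] unfolding cancel by simp
    moreover have "F = conj_arr Z \<beta> (Z_conj_arr T (inv \<beta>) F)"
      using Arr by (simp add: Z_conj_arr_closed Z_conj_arr_mult Z_conj_arr_one)
    ultimately show "F \<in> conj_arr Z \<beta> ` Component_arr Z \<alpha>" by (rule rev_image_eqI)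
  qed
qed

lemma braided_T_category_Z: "braided_T_category G Z"
proof (intro braided_T_category.intro braided_T_category_axioms.intro)
  show "T_category G Z" by (rule T_category_Z)
  show "Braid Z X Y \<in> Hom Z (X \<boxtimes>\<^bsub>Z\<^esub> Y) (act_obj G Z X Y \<boxtimes>\<^bsub>Z\<^esub> X)"
    if "X \<in> Obj Z" "Y \<in> Obj Z" for X Y
    using that by (simp add: Hom_Z act_obj_def Z_Arr_Braid)
  show "is_iso Z (Braid Z X Y)" if "X \<in> Obj Z" "Y \<in> Obj Z" for X Y
    using that by (simp add: is_iso_Z Z_Arr_Braid Braid_iso Z_Obj_typing)
  show "(conj_arr Z \<alpha> E \<boxdot>\<^bsub>Z\<^esub> F) \<bullet>\<^bsub>Z\<^esub> Braid Z X Y = Braid Z X' Y' \<bullet>\<^bsub>Z\<^esub> (F \<boxdot>\<^bsub>Z\<^esub> E)"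
    if "\<alpha> \<in> carrier G" "X \<in> Component Z \<alpha>" "X' \<in> Component Z \<alpha>" "F \<in> Hom Z X X'" "E \<in> Hom Z Y Y'"
    for \<alpha> X X' F Y Y' E
  proof -
    obtain f where f: "F = (X, f, X')" "f \<in> Arr T" "Dom T f = fst X" "Cod T f = fst X'"
      using \<open>F \<in> Hom Z X X'\<close> by (rule HomE_Z)
    obtain e where e: "E = (Y, e, Y')" "(Y, e, Y') \<in> Z_Arr G T" "e \<in> Arr T"
      "Dom T e = fst Y" "Cod T e = fst Y'"
      using \<open>E \<in> Hom Z Y Y'\<close> by (rule HomE_Z)
    \<comment> \<open>Both are needed: the first is the exponent in the underlying square, the
      second occurs in the codomain of \<open>Braid Z X' Y'\<close>.\<close>
    have "deg (fst X) = \<alpha>" "deg (fst X') = \<alpha>"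
      using that by (simp_all add: Component_iff)
    then show ?thesis
      using f e Braid_natural_Arr[of f e] by simp
  qed
  show "Braid Z (X \<boxtimes>\<^bsub>Z\<^esub> Y) W =
      (Braid Z X (act_obj G Z Y W) \<boxdot>\<^bsub>Z\<^esub> Idt Z Y) \<bullet>\<^bsub>Z\<^esub> (Idt Z X \<boxdot>\<^bsub>Z\<^esub> Braid Z Y W)"
    if "X \<in> Obj Z" "Y \<in> Obj Z" "W \<in> Obj Z" for X Y W
    \<comment> \<open>\<open>Z_tens_assoc\<close> and \<open>Z_conj_obj_mult\<close> match the end
      objects with their twists; only the middle entry is the hexagon of \<open>T\<close>.\<close>
    using that by (simp add: act_obj_def Z_Obj_typing Z_tens_sel Z_tens_assoc
        Z_conj_obj_mult Braid_Tens_left)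
  show "Braid Z X (Y \<boxtimes>\<^bsub>Z\<^esub> W) =
      (Idt Z (act_obj G Z X Y) \<boxdot>\<^bsub>Z\<^esub> Braid Z X W) \<bullet>\<^bsub>Z\<^esub> (Braid Z X Y \<boxdot>\<^bsub>Z\<^esub> Idt Z W)"
    if "X \<in> Obj Z" "Y \<in> Obj Z" "W \<in> Obj Z" for X Y W
    using that by (simp add: act_obj_def Z_Obj_typing Z_tens_sel Z_tens_assoc
        Z_conj_obj_tens Braid_Tens_right)
  show "conj_arr Z \<beta> (Braid Z X Y) = Braid Z (conj_obj Z \<beta> X) (conj_obj Z \<beta> Y)"
    if "\<beta> \<in> carrier G" "X \<in> Obj Z" "Y \<in> Obj Z" for \<beta> X Y
    using that by (simp add: Z_Arr_Braid Z_Obj_typing Z_conj_obj_tens Z_conj_obj_mult m_assoc)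
qed

text \<open>The twist axioms are built into the construction: naturality is the condition defining
  arrows, the tensor axiom is the formula for t \<odot> t', and compatibility with conjugation is
  the formula for conjugated objects.\<close>

lemma balanced_T_category_Z: "balanced_T_category G Z"
proof (intro balanced_T_category.intro balanced_T_category_axioms.intro)
  show "braided_T_category G Z" by (rule braided_T_category_Z)
  show "Twist Z X \<in> Hom Z X (act_obj G Z X X)" if "X \<in> Obj Z" for X
    using that by (simp add: Hom_Z act_obj_def Z_Arr_Twist)
  show "is_iso Z (Twist Z X)" if "X \<in> Obj Z" for X
    using that is_iso_Z[OF Z_Arr_Twist, of X] by (simp add: Z_Obj_iff)
  show "Twist Z Y \<bullet>\<^bsub>Z\<^esub> F = conj_arr Z \<alpha> F \<bullet>\<^bsub>Z\<^esub> Twist Z X"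
    if "\<alpha> \<in> carrier G" "X \<in> Component Z \<alpha>" "Y \<in> Component Z \<alpha>" "F \<in> Hom Z X Y" for \<alpha> X Y F
  proof -
    obtain f where f: "F = (X, f, Y)" "(X, f, Y) \<in> Z_Arr G T"
      using \<open>F \<in> Hom Z X Y\<close> by (rule HomE_Z)
    have "deg (fst X) = \<alpha>" "deg (fst Y) = \<alpha>"
      using that by (simp_all add: Component_iff)
    then show ?thesis
      using f Z_Arr_twist_compat[OF f(2)] by simp
  qed
  show "Twist Z (X \<boxtimes>\<^bsub>Z\<^esub> Y) =
      Braid Z (act_obj G Z (X \<boxtimes>\<^bsub>Z\<^esub> Y) Y) (act_obj G Z X X) \<bullet>\<^bsub>Z\<^esub>
      Braid Z (act_obj G Z X X) (act_obj G Z Y Y) \<bullet>\<^bsub>Z\<^esub> (Twist Z X \<boxdot>\<^bsub>Z\<^esub> Twist Z Y)"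
    if "X \<in> Obj Z" "Y \<in> Obj Z" for X Y
    using that by (simp add: act_obj_def Z_Obj_typing Z_tens_sel Z_conj_obj_tens Z_conj_obj_mult
        monodromy_def Comp_assoc_Arr m_assoc inv_mult_group)
  show "conj_arr Z \<alpha> (Twist Z X) = Twist Z (conj_obj Z \<alpha> X)"
    if "\<alpha> \<in> carrier G" "X \<in> Obj Z" for \<alpha> X
    using that by (simp add: Z_Arr_Twist Z_Obj_typing Z_conj_obj_mult m_assoc)
qed

end

theorem mainTheorem7:
  fixes \<pi> :: "('g, 'r) monoid_scheme"
    and T :: "('o, 'm, 'g, 'x) braided_T_category_scheme"
  assumes "group \<pi>"
    and "braided_T_category \<pi> T"
  shows "balanced_T_category \<pi> (twist_extension \<pi> T)"
  using assms(2) by (rule braided_T_category.balanced_T_category_Z)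

end
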